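(* Let $k$ be a field, $Q$ a quiver and $X$ a perfect $Q$-algebraic branching system. Then the associated representation $\mathcal{M}(X)$ of $L_k(Q)$ is irreducible if and only if $X$ is isomorphic, as a $Q$-algebraic branching system, to $[p]$ for some left-infinite path $p$ in $Q$ or to $N_i$ for some sink $i$ in $Q$.
   Context: A quiver $Q=(Q_0,Q_1;s,t)$ consists of a set $Q_0$ of vertices, a set $Q_1$ of arrows and maps $s,t\colon Q_1\to Q_0$ (starting and terminating vertex). A vertex is a sink if no arrow starts at it, an infinite emitter if infinitely many arrows start at it, and regular if it is neither. A finite path of length $n\ge1$ is a sequence $p=\alpha_n\cdots\alpha_2\alpha_1$ of arrows with $t(\alpha_i)=s(\alpha_{i+1})$; $s(p)=s(\alpha_1)$, $t(p)=t(\alpha_n)$ (it starts with $\alpha_1$); for each vertex $i$ there is a trivial path $e_i$ of length $0$ with $s(e_i)=t(e_i)=i$. Concatenation is written from right to left. A left-infinite path is an infinite sequence $p=\cdots\alpha_n\cdots\alpha_2\alpha_1$ of arrows with $t(\alpha_i)=s(\alpha_{i+1})$ for all $i\ge1$; $s(p)=s(\alpha_1)$ (it starts with $\alpha_1$). For $n\ge0$, $\tau_{>n}(p)=\cdots\alpha_{n+2}\alpha_{n+1}$. Left-infinite paths $p,q$ are tail-equivalent if $\tau_{>n}(p)=\tau_{>m}(q)$ for some $n,m\ge0$; $[p]$ is the class of $p$. Leavitt path algebra: $L_k(Q)$ is the $k$-algebra (algebras are not required to be unital) given by generators $\{e_i,\alpha,\alpha^*\mid i\in Q_0,\alpha\in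 Q_1\}$ subject to: (0) $e_ie_j=\delta_{ij}e_i$ for $i,j\in Q_0$; (1) $e_{t(\alpha)}\alpha=\alpha=\alpha e_{s(\alpha)}$; (2) $e_{s(\alpha)}\alpha^*=\alpha^*=\alpha^*e_{t(\alpha)}$; (3) $\alpha\beta^*=\delta_{\alpha,\beta}e_{t(\alpha)}$ for $\alpha,\beta\in Q_1$; (4) $\sum_{\{\alpha\in Q_1\mid s(\alpha)=i\}}\alpha^*\alpha=e_i$ for every regular vertex $i$. A representation is a $k$-vector space $M$ with an algebra homomorphism $L_k(Q)\to{\rm End}_k(M)$; it is irreducible if it is nonzero and has no subrepresentations other than $0$ and itself. A $Q$-algebraic branching system consists of a set $X$, a family of subsets $\{X_i,X_\alpha\mid i\in Q_0,\alpha\in Q_1\}$ of $X$, and a bijection $\sigma_\alpha\colon X_{t(\alpha)}\to X_\alpha$ for each arrow $\alpha$, such that: (1) $X_i\cap X_j=\emptyset=X_\alpha\cap X_\beta$ for $i\ne j$, $\alpha\ne\beta$; (2) $X_\alpha\subseteq X_{s(\alpha)}$ for each $\alpha\in Q_1$; (3) $X_i=\bigcup_{\{\alpha\in Q_1\mid s(\alpha)=i\}}X_\alpha$ for each regular vertex $i$. It is saturated if $X=\bigcup_{i\in Q_0}X_i$, and perfect if it is saturated and the equation in (3) holds for every non-sink vertex $i$. A morphism $f\colon X\to Y$ of $Q$-algebraic branching systems is a map with $f(X_i)\subseteq Y_i$ and $f(X_\alpha)\subseteq Y_\alpha$ for all $i,\alpha$, compatible with the bijections ($f(\sigma_\alpha(x))=\sigma_\alpha(f(x))$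 for $x\in X_{t(\alpha)}$); $X$ and $Y$ are isomorphic if there exist mutually inverse morphisms between them. Associated representation: $\mathcal{M}(X)$ is the $k$-vector space of all functions $X\to k$ vanishing on all but finitely many elements; it has basis the characteristic functions $\chi_x$, $x\in X$. $L_k(Q)$ acts by: $e_i.\chi_x=\chi_x$ if $x\in X_i$, and $0$ otherwise; $\alpha.\chi_x=\chi_{\sigma_\alpha^{-1}(x)}$ if $x\in X_\alpha$, and $0$ otherwise; $\alpha^*.\chi_x=\chi_{\sigma_\alpha(x)}$ if $x\in X_{t(\alpha)}$, and $0$ otherwise. For a left-infinite path $p$, the set $[p]$ is a $Q$-algebraic branching system with $[p]_i=\{q\in[p]\mid s(q)=i\}$, $[p]_\alpha=\{q\in[p]\mid q\text{ starts with }\alpha\}$, and $\sigma_\alpha(q)=q\alpha$. For a sink $i$, $N_i$ is the set of finite paths terminating at $i$ (including $e_i$), a $Q$-algebraic branching system with $(N_i)_j=\{q\in N_i\mid s(q)=j\}$, $(N_i)_\alpha=\{q\in N_i\mid q\text{ starts with }\alpha\}$, and $\sigma_\alpha(q)=q\alpha$. *)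

theory Defs
  imports
    "Graph_Theory.Digraph"
    "Graph_Theory.Arc_Walk"
    "HOL-Library.Poly_Mapping"
    "HOL-Library.FuncSet"
    "HOL-Library.Stream"
begin

section \<open>Vector spaces, non-unital algebras and representations\<close>

record ('k, 'm) vspace =
  vcarrier :: "'m set"
  vzero :: 'm
  vadd :: "'m \<Rightarrow> 'm \<Rightarrow> 'm"
  vscale :: "'k \<Rightarrow> 'm \<Rightarrow> 'm"

record ('k, 'a) kalg = "('k, 'a) vspace" +
  amult :: "'a \<Rightarrow> 'a \<Rightarrow> 'a"

locale kspace =
  fixes V :: "('k::field, 'm, 'z) vspace_scheme"
  assumes zero_closed: "vzero V \<in> vcarrier V"
    and add_closed: "\<lbrakk>x \<in> vcarrier V; y \<in> vcarrier V\<rbrakk> \<Longrightarrow> vadd V x y \<in> vcarrier V"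
    and scale_closed: "x \<in> vcarrier V \<Longrightarrow> vscale V c x \<in> vcarrier V"
    and add_assoc: "\<lbrakk>x \<in> vcarrier V; y \<in> vcarrier V; z \<in> vcarrier V\<rbrakk>
          \<Longrightarrow> vadd V (vadd V x y) z = vadd V x (vadd V y z)"
    and add_comm: "\<lbrakk>x \<in> vcarrier V; y \<in> vcarrier V\<rbrakk> \<Longrightarrow> vadd V x y = vadd V y x"
    and add_zero: "x \<in> vcarrier V \<Longrightarrow> vadd V x (vzero V) = x"
    and add_inverse: "x \<in> vcarrier V \<Longrightarrow> \<exists>y\<in>vcarrier V. vadd V x y = vzero V"
    and scale_one: "x \<in> vcarrier V \<Longrightarrow> vscale V 1 x = x"
    and scale_scale: "x \<in> vcarrier V \<Longrightarrow> vscale V c (vscale V d x) = vscale V (c * d) x"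
    and scale_add_left: "x \<in> vcarrier V
          \<Longrightarrow> vscale V (c + d) x = vadd V (vscale V c x) (vscale V d x)"
    and scale_add_right: "\<lbrakk>x \<in> vcarrier V; y \<in> vcarrier V\<rbrakk>
          \<Longrightarrow> vscale V c (vadd V x y) = vadd V (vscale V c x) (vscale V c y)"

locale kalgebra = kspace A
  for A :: "('k::field, 'a, 'z) kalg_scheme" +
  assumes mult_closed: "\<lbrakk>x \<in> vcarrier A; y \<in> vcarrier A\<rbrakk> \<Longrightarrow> amult A x y \<in> vcarrier A"
    and mult_assoc: "\<lbrakk>x \<in> vcarrier A; y \<in> vcarrier A; z \<in> vcarrier A\<rbrakk>
          \<Longrightarrow> amult A (amult A x y) z = amult A x (amult A y z)"
    and mult_add_left: "\<lbrakk>x \<in> vcarrier A; y \<in> vcarrier A; z \<in> vcarrier A\<rbrakk>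
          \<Longrightarrow> amult A (vadd A x y) z = vadd A (amult A x z) (amult A y z)"
    and mult_add_right: "\<lbrakk>x \<in> vcarrier A; y \<in> vcarrier A; z \<in> vcarrier A\<rbrakk>
          \<Longrightarrow> amult A x (vadd A y z) = vadd A (amult A x y) (amult A x z)"
    and mult_scale_left: "\<lbrakk>x \<in> vcarrier A; y \<in> vcarrier A\<rbrakk>
          \<Longrightarrow> amult A (vscale A c x) y = vscale A c (amult A x y)"
    and mult_scale_right: "\<lbrakk>x \<in> vcarrier A; y \<in> vcarrier A\<rbrakk>
          \<Longrightarrow> amult A x (vscale A c y) = vscale A c (amult A x y)"

text \<open>Endomorphisms are extensional functions, so that equality in \<open>End_alg V\<close> is equality of
  maps on the carrier.\<close>

definition End_alg :: "('k::field, 'm, 'z) vspace_scheme \<Rightarrow> ('k, 'm \<Rightarrow> 'm) kalg" where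
  "End_alg V = \<lparr>
     vcarrier = {f \<in> vcarrier V \<rightarrow>\<^sub>E vcarrier V.
       (\<forall>x\<in>vcarrier V. \<forall>y\<in>vcarrier V. f (vadd V x y) = vadd V (f x) (f y)) \<and>
       (\<forall>c. \<forall>x\<in>vcarrier V. f (vscale V c x) = vscale V c (f x))},
     vzero = (\<lambda>x\<in>vcarrier V. vzero V),
     vadd = (\<lambda>f g. \<lambda>x\<in>vcarrier V. vadd V (f x) (g x)),
     vscale = (\<lambda>c f. \<lambda>x\<in>vcarrier V. vscale V c (f x)),
     amult = (\<lambda>f g. compose (vcarrier V) f g)\<rparr>"

definition alg_hom ::
  "('k::field, 'a, 'y) kalg_scheme \<Rightarrow> ('k, 'b, 'z) kalg_scheme \<Rightarrow> ('a \<Rightarrow> 'b) set" where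
  "alg_hom A B = {\<phi>. \<phi> ` vcarrier A \<subseteq> vcarrier B \<and>
     (\<forall>x\<in>vcarrier A. \<forall>y\<in>vcarrier A. \<phi> (vadd A x y) = vadd B (\<phi> x) (\<phi> y)) \<and>
     (\<forall>c. \<forall>x\<in>vcarrier A. \<phi> (vscale A c x) = vscale B c (\<phi> x)) \<and>
     (\<forall>x\<in>vcarrier A. \<forall>y\<in>vcarrier A. \<phi> (amult A x y) = amult B (\<phi> x) (\<phi> y))}"

definition representation ::
  "('k::field, 'a, 'y) kalg_scheme \<Rightarrow> ('k, 'm, 'z) vspace_scheme \<Rightarrow> ('a \<Rightarrow> 'm \<Rightarrow> 'm) \<Rightarrow> bool" where
  "representation A V \<rho> \<longleftrightarrow> kspace V \<and> \<rho> \<in> alg_hom A (End_alg V)"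

definition vsubspace :: "('k::field, 'm, 'z) vspace_scheme \<Rightarrow> 'm set \<Rightarrow> bool" where
  "vsubspace V U \<longleftrightarrow> U \<subseteq> vcarrier V \<and> vzero V \<in> U \<and>
     (\<forall>x\<in>U. \<forall>y\<in>U. vadd V x y \<in> U) \<and> (\<forall>c. \<forall>x\<in>U. vscale V c x \<in> U)"

definition subrepresentation ::
  "('k::field, 'a, 'y) kalg_scheme \<Rightarrow> ('k, 'm, 'z) vspace_scheme \<Rightarrow> ('a \<Rightarrow> 'm \<Rightarrow> 'm)
    \<Rightarrow> 'm set \<Rightarrow> bool" where
  "subrepresentation A V \<rho> U \<longleftrightarrow> vsubspace V U \<and> (\<forall>a\<in>vcarrier A. \<forall>u\<in>U. \<rho> a u \<in> U)"

definition irreducible_representation ::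
  "('k::field, 'a, 'y) kalg_scheme \<Rightarrow> ('k, 'm, 'z) vspace_scheme \<Rightarrow> ('a \<Rightarrow> 'm \<Rightarrow> 'm) \<Rightarrow> bool" where
  "irreducible_representation A V \<rho> \<longleftrightarrow> representation A V \<rho> \<and> vcarrier V \<noteq> {vzero V} \<and>
     (\<forall>U. subrepresentation A V \<rho> U \<longrightarrow> U = {vzero V} \<or> U = vcarrier V)"


section \<open>Finitely supported functions\<close>

definition pscale :: "'k::field \<Rightarrow> ('a \<Rightarrow>\<^sub>0 'k) \<Rightarrow> ('a \<Rightarrow>\<^sub>0 'k)" where
  "pscale c f = Poly_Mapping.map ((*) c) f"

text \<open>Linear extension of a map given on the basis of characteristic functions \<open>single x 1\<close>.\<close>

definition lin_ext :: "('a \<Rightarrow> ('b \<Rightarrow>\<^sub>0 'k::field)) \<Rightarrow> ('a \<Rightarrow>\<^sub>0 'k) \<Rightarrow> ('b \<Rightarrow>\<^sub>0 'k)" where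
  "lin_ext u f = (\<Sum>x\<in>Poly_Mapping.keys f. pscale (Poly_Mapping.lookup f x) (u x))"


section \<open>Quivers\<close>

text \<open>A quiver is a \<open>wf_digraph\<close>, with \<open>tail\<close> and \<open>head\<close> as the maps \<open>s\<close> and \<open>t\<close>.\<close>

definition sink :: "('v, 'e) pre_digraph \<Rightarrow> 'v \<Rightarrow> bool" where
  "sink Q i \<longleftrightarrow> i \<in> verts Q \<and> out_arcs Q i = {}"

definition infinite_emitter :: "('v, 'e) pre_digraph \<Rightarrow> 'v \<Rightarrow> bool" where
  "infinite_emitter Q i \<longleftrightarrow> i \<in> verts Q \<and> infinite (out_arcs Q i)"

definition regular_vertex :: "('v, 'e) pre_digraph \<Rightarrow> 'v \<Rightarrow> bool" where
  "regular_vertex Q i \<longleftrightarrow> i \<in> verts Q \<and> \<not> sink Q i \<and> \<not> infinite_emitter Q i"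


section \<open>The Leavitt path algebra\<close>

datatype ('v, 'e) lgen = Vert 'v | Arr 'e | Ghost 'e

definition lgens :: "('v, 'e) pre_digraph \<Rightarrow> ('v, 'e) lgen set" where
  "lgens Q = Vert ` verts Q \<union> Arr ` arcs Q \<union> Ghost ` arcs Q"

text \<open>The free monoid, written additively so that \<open>_ gword \<Rightarrow>\<^sub>0 'k\<close> carries the convolution
  product of \<open>Poly_Mapping\<close> and is the free unital algebra.\<close>

datatype 'g gword = Word (letters: "'g list")

instantiation gword :: (type) monoid_add
begin
definition zero_gword :: "'a gword" where "0 = Word []"
definition plus_gword :: "'a gword \<Rightarrow> 'a gword \<Rightarrow> 'a gword"
  where "u + w = Word (letters u @ letters w)"
instance by standard (simp_all add: zero_gword_def plus_gword_def)
end

type_synonym ('v, 'e, 'k) falg = "('v, 'e) lgen gword \<Rightarrow>\<^sub>0 'k"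

text \<open>The free non-unital algebra on the generators: no constant term, and only letters that
  come from vertices and arrows of \<open>Q\<close>.\<close>

definition free_carrier :: "('v, 'e) pre_digraph \<Rightarrow> ('v, 'e, 'k::field) falg set" where
  "free_carrier Q = {a. \<forall>w\<in>Poly_Mapping.keys a. letters w \<noteq> [] \<and> set (letters w) \<subseteq> lgens Q}"

definition gen :: "('v, 'e) lgen \<Rightarrow> ('v, 'e, 'k::field) falg" where
  "gen g = Poly_Mapping.single (Word [g]) 1"

text \<open>Each relation \<open>l = r\<close> is recorded as \<open>l - r\<close>.\<close>

inductive_set leavitt_relations :: "('v, 'e) pre_digraph \<Rightarrow> ('v, 'e, 'k::field) falg set"
  for Q :: "('v, 'e) pre_digraph" where
  orth: "\<lbrakk>i \<in> verts Q; j \<in> verts Q\<rbrakk>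
    \<Longrightarrow> gen (Vert i) * gen (Vert j) - (if i = j then gen (Vert i) else 0) \<in> leavitt_relations Q"
| head_arr: "\<alpha> \<in> arcs Q
    \<Longrightarrow> gen (Vert (head Q \<alpha>)) * gen (Arr \<alpha>) - gen (Arr \<alpha>) \<in> leavitt_relations Q"
| arr_tail: "\<alpha> \<in> arcs Q
    \<Longrightarrow> gen (Arr \<alpha>) * gen (Vert (tail Q \<alpha>)) - gen (Arr \<alpha>) \<in> leavitt_relations Q"
| tail_ghost: "\<alpha> \<in> arcs Q
    \<Longrightarrow> gen (Vert (tail Q \<alpha>)) * gen (Ghost \<alpha>) - gen (Ghost \<alpha>) \<in> leavitt_relations Q"
| ghost_head: "\<alpha> \<in> arcs Q
    \<Longrightarrow> gen (Ghost \<alpha>) * gen (Vert (head Q \<alpha>)) - gen (Ghost \<alpha>) \<in> leavitt_relations Q"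
| arr_ghost: "\<lbrakk>\<alpha> \<in> arcs Q; \<beta> \<in> arcs Q\<rbrakk>
    \<Longrightarrow> gen (Arr \<alpha>) * gen (Ghost \<beta>) - (if \<alpha> = \<beta> then gen (Vert (head Q \<alpha>)) else 0)
          \<in> leavitt_relations Q"
| ghost_arr: "regular_vertex Q i
    \<Longrightarrow> (\<Sum>\<alpha>\<in>out_arcs Q i. gen (Ghost \<alpha>) * gen (Arr \<alpha>)) - gen (Vert i) \<in> leavitt_relations Q"

inductive_set leavitt_ideal :: "('v, 'e) pre_digraph \<Rightarrow> ('v, 'e, 'k::field) falg set"
  for Q :: "('v, 'e) pre_digraph" where
  rel: "r \<in> leavitt_relations Q \<Longrightarrow> r \<in> leavitt_ideal Q"
| zero: "0 \<in> leavitt_ideal Q"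
| add: "\<lbrakk>a \<in> leavitt_ideal Q; b \<in> leavitt_ideal Q\<rbrakk> \<Longrightarrow> a + b \<in> leavitt_ideal Q"
| scale: "a \<in> leavitt_ideal Q \<Longrightarrow> pscale c a \<in> leavitt_ideal Q"
| mult_left: "\<lbrakk>a \<in> leavitt_ideal Q; b \<in> free_carrier Q\<rbrakk> \<Longrightarrow> b * a \<in> leavitt_ideal Q"
| mult_right: "\<lbrakk>a \<in> leavitt_ideal Q; b \<in> free_carrier Q\<rbrakk> \<Longrightarrow> a * b \<in> leavitt_ideal Q"

definition lcoset :: "('v, 'e) pre_digraph \<Rightarrow> ('v, 'e, 'k::field) falg \<Rightarrow> ('v, 'e, 'k) falg set"
  where "lcoset Q a = (+) a ` leavitt_ideal Q"

definition leavitt_path_algebra ::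
  "('v, 'e) pre_digraph \<Rightarrow> ('k::field, ('v, 'e, 'k) falg set) kalg" where
  "leavitt_path_algebra Q = \<lparr>
     vcarrier = lcoset Q ` free_carrier Q,
     vzero = lcoset Q 0,
     vadd = (\<lambda>S T. \<Union>a\<in>S. \<Union>b\<in>T. lcoset Q (a + b)),
     vscale = (\<lambda>c S. \<Union>a\<in>S. lcoset Q (pscale c a)),
     amult = (\<lambda>S T. \<Union>a\<in>S. \<Union>b\<in>T. lcoset Q (a * b))\<rparr>"


section \<open>Algebraic branching systems\<close>

record ('v, 'e, 'x) branching =
  points :: "'x set"
  vset :: "'v \<Rightarrow> 'x set"
  aset :: "'e \<Rightarrow> 'x set"
  sig :: "'e \<Rightarrow> 'x \<Rightarrow> 'x"

locale branching_system = wf_digraph Q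
  for Q :: "('v, 'e) pre_digraph" +
  fixes X :: "('v, 'e, 'x) branching"
  assumes vset_points: "i \<in> verts Q \<Longrightarrow> vset X i \<subseteq> points X"
    and aset_points: "\<alpha> \<in> arcs Q \<Longrightarrow> aset X \<alpha> \<subseteq> points X"
    and sig_bij: "\<alpha> \<in> arcs Q \<Longrightarrow> bij_betw (sig X \<alpha>) (vset X (head Q \<alpha>)) (aset X \<alpha>)"
    and vset_disjoint: "\<lbrakk>i \<in> verts Q; j \<in> verts Q; i \<noteq> j\<rbrakk> \<Longrightarrow> vset X i \<inter> vset X j = {}"
    and aset_disjoint: "\<lbrakk>\<alpha> \<in> arcs Q; \<beta> \<in> arcs Q; \<alpha> \<noteq> \<beta>\<rbrakk> \<Longrightarrow> aset X \<alpha> \<inter> aset X \<beta> = {}"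
    and aset_vset: "\<alpha> \<in> arcs Q \<Longrightarrow> aset X \<alpha> \<subseteq> vset X (tail Q \<alpha>)"
    and vset_regular: "regular_vertex Q i \<Longrightarrow> vset X i = (\<Union>\<alpha>\<in>out_arcs Q i. aset X \<alpha>)"

definition saturated_bs :: "('v, 'e) pre_digraph \<Rightarrow> ('v, 'e, 'x) branching \<Rightarrow> bool" where
  "saturated_bs Q X \<longleftrightarrow> points X = (\<Union>i\<in>verts Q. vset X i)"

definition perfect_bs :: "('v, 'e) pre_digraph \<Rightarrow> ('v, 'e, 'x) branching \<Rightarrow> bool" where
  "perfect_bs Q X \<longleftrightarrow> saturated_bs Q X \<and>
     (\<forall>i\<in>verts Q. \<not> sink Q i \<longrightarrow> vset X i = (\<Union>\<alpha>\<in>out_arcs Q i. aset X \<alpha>))"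

definition bs_morphism ::
  "('v, 'e) pre_digraph \<Rightarrow> ('v, 'e, 'x) branching \<Rightarrow> ('v, 'e, 'y) branching \<Rightarrow> ('x \<Rightarrow> 'y) \<Rightarrow> bool"
  where
  "bs_morphism Q X Y f \<longleftrightarrow> f ` points X \<subseteq> points Y \<and>
     (\<forall>i\<in>verts Q. f ` vset X i \<subseteq> vset Y i) \<and>
     (\<forall>\<alpha>\<in>arcs Q. f ` aset X \<alpha> \<subseteq> aset Y \<alpha>) \<and>
     (\<forall>\<alpha>\<in>arcs Q. \<forall>x\<in>vset X (head Q \<alpha>). f (sig X \<alpha> x) = sig Y \<alpha> (f x))"

definition bs_isomorphic ::
  "('v, 'e) pre_digraph \<Rightarrow> ('v, 'e, 'x) branching \<Rightarrow> ('v, 'e, 'y) branching \<Rightarrow> bool" where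
  "bs_isomorphic Q X Y \<longleftrightarrow> (\<exists>f g. bs_morphism Q X Y f \<and> bs_morphism Q Y X g \<and>
     (\<forall>x\<in>points X. g (f x) = x) \<and> (\<forall>y\<in>points Y. f (g y) = y))"


section \<open>The associated representation\<close>

text \<open>Functions on \<open>points X\<close> are extended by zero to the ambient type.\<close>

definition assoc_space :: "('v, 'e, 'x) branching \<Rightarrow> ('k::field, 'x \<Rightarrow>\<^sub>0 'k) vspace" where
  "assoc_space X = \<lparr>vcarrier = {f. Poly_Mapping.keys f \<subseteq> points X}, vzero = 0, vadd = (+), vscale = pscale\<rparr>"

primrec basis_act ::
  "('v, 'e) pre_digraph \<Rightarrow> ('v, 'e, 'x) branching \<Rightarrow> ('v, 'e) lgen \<Rightarrow> 'x \<Rightarrow> ('x \<Rightarrow>\<^sub>0 'k::field)"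
  where
  "basis_act Q X (Vert i) x = (if x \<in> vset X i then Poly_Mapping.single x 1 else 0)"
| "basis_act Q X (Arr \<alpha>) x = (if x \<in> aset X \<alpha>
     then Poly_Mapping.single (inv_into (vset X (head Q \<alpha>)) (sig X \<alpha>) x) 1 else 0)"
| "basis_act Q X (Ghost \<alpha>) x = (if x \<in> vset X (head Q \<alpha>)
     then Poly_Mapping.single (sig X \<alpha> x) 1 else 0)"

text \<open>A word \<open>g\<^sub>1 \<dots> g\<^sub>n\<close> acts as the composite of its letters, \<open>g\<^sub>n\<close> being applied first.\<close>

definition word_act ::
  "('v, 'e) pre_digraph \<Rightarrow> ('v, 'e, 'x) branching \<Rightarrow> ('v, 'e) lgen gword
    \<Rightarrow> ('x \<Rightarrow>\<^sub>0 'k::field) \<Rightarrow> ('x \<Rightarrow>\<^sub>0 'k)" where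
  "word_act Q X w = foldr (\<lambda>g. lin_ext (basis_act Q X g)) (letters w)"

definition free_act ::
  "('v, 'e) pre_digraph \<Rightarrow> ('v, 'e, 'x) branching \<Rightarrow> ('v, 'e, 'k::field) falg
    \<Rightarrow> ('x \<Rightarrow>\<^sub>0 'k) \<Rightarrow> ('x \<Rightarrow>\<^sub>0 'k)" where
  "free_act Q X a f = lin_ext (\<lambda>w. word_act Q X w f) a"

text \<open>Independence of the chosen representative of the coset, and the defining formulas on
  generators, are proved at the end of this theory.\<close>

definition assoc_rep ::
  "('v, 'e) pre_digraph \<Rightarrow> ('v, 'e, 'x) branching \<Rightarrow> ('v, 'e, 'k::field) falg set
    \<Rightarrow> ('x \<Rightarrow>\<^sub>0 'k) \<Rightarrow> ('x \<Rightarrow>\<^sub>0 'k)" where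
  "assoc_rep Q X S = (\<lambda>f\<in>vcarrier (assoc_space X). free_act Q X (SOME a. a \<in> S) f)"


section \<open>The branching systems of left-infinite paths and of sinks\<close>

text \<open>The path \<open>\<dots>\<alpha>\<^sub>2\<alpha>\<^sub>1\<close> is the stream whose head is \<open>\<alpha>\<^sub>1\<close>; thus \<open>\<tau>\<^bsub>>n\<^esub>\<close> is \<open>sdrop n\<close> and
  \<open>q\<alpha>\<close> is \<open>\<alpha> ## q\<close>.\<close>

definition left_infinite_path :: "('v, 'e) pre_digraph \<Rightarrow> 'e stream \<Rightarrow> bool" where
  "left_infinite_path Q p \<longleftrightarrow> (\<forall>n. p !! n \<in> arcs Q \<and> head Q (p !! n) = tail Q (p !! Suc n))"

definition tail_equivalent :: "'e stream \<Rightarrow> 'e stream \<Rightarrow> bool" where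
  "tail_equivalent p q \<longleftrightarrow> (\<exists>n m. sdrop n p = sdrop m q)"

definition tail_bs :: "('v, 'e) pre_digraph \<Rightarrow> 'e stream \<Rightarrow> ('v, 'e, 'e stream) branching" where
  "tail_bs Q p = (let C = {q. left_infinite_path Q q \<and> tail_equivalent p q} in \<lparr>
     points = C,
     vset = (\<lambda>i. {q \<in> C. tail Q (shd q) = i}),
     aset = (\<lambda>\<alpha>. {q \<in> C. shd q = \<alpha>}),
     sig = (\<lambda>\<alpha> q. \<alpha> ## q)\<rparr>)"

text \<open>A finite path \<open>\<alpha>\<^sub>n\<dots>\<alpha>\<^sub>1\<close> starting at \<open>u\<close> is the pair of \<open>u\<close> and the list
  \<open>[\<alpha>\<^sub>1, \<dots>, \<alpha>\<^sub>n]\<close>; the trivial path \<open>e\<^sub>i\<close> is \<open>(i, [])\<close>.\<close>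

definition sink_bs :: "('v, 'e) pre_digraph \<Rightarrow> 'v \<Rightarrow> ('v, 'e, 'v \<times> 'e list) branching" where
  "sink_bs Q i = (let N = {(u, w). pre_digraph.awalk Q u w i} in \<lparr>
     points = N,
     vset = (\<lambda>j. {q \<in> N. fst q = j}),
     aset = (\<lambda>\<alpha>. {q \<in> N. snd q \<noteq> [] \<and> hd (snd q) = \<alpha>}),
     sig = (\<lambda>\<alpha> q. (tail Q \<alpha>, \<alpha> # snd q))\<rparr>)"


section \<open>Well-definedness\<close>

subsection \<open>Linear extension\<close>

lemma lookup_pscale [simp]: "Poly_Mapping.lookup (pscale c f) x = c * Poly_Mapping.lookup f x"
  unfolding pscale_def by transfer (simp add: when_def)

lemma pscale_simps [simp]:
  "pscale c 0 = 0" "pscale 0 f = 0" "pscale 1 f = f" "pscale c (pscale d f) = pscale (c * d) f"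
  by (simp_all add: poly_mapping_eq_iff fun_eq_iff mult.assoc)

lemma pscale_add: "pscale c (f + g) = pscale c f + pscale c g"
  and pscale_diff: "pscale c (f - g) = pscale c f - pscale c g"
  and pscale_add_left: "pscale (c + d) f = pscale c f + pscale d f"
  and pscale_minus_one: "pscale (- 1) f = - f"
  by (simp_all add: poly_mapping_eq_iff fun_eq_iff lookup_add lookup_minus algebra_simps)

lemma pscale_single [simp]: "pscale c (Poly_Mapping.single x d) = Poly_Mapping.single x (c * d)"
  by (simp add: poly_mapping_eq_iff fun_eq_iff lookup_single when_def)

lemma pscale_sum: "pscale c (\<Sum>x\<in>A. f x) = (\<Sum>x\<in>A. pscale c (f x))"
  by (induction A rule: infinite_finite_induct) (simp_all add: pscale_add)

lemma keys_pscale: "Poly_Mapping.keys (pscale c f) \<subseteq> Poly_Mapping.keys f"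
  by (auto simp: in_keys_iff)

lemma pscale_conv_mult: "pscale c a = Poly_Mapping.single 0 c * a"
  by (simp add: pscale_def mult_map_scale_conv_mult)

lemma pscale_mult_left: "pscale c a * b = pscale c (a * b)"
  for a b :: "'a::monoid_add \<Rightarrow>\<^sub>0 'k::field"
  by (simp add: pscale_conv_mult mult.assoc)

lemma poly_mapping_sum_single:
  fixes f :: "'a \<Rightarrow>\<^sub>0 'k::comm_monoid_add"
  shows "f = (\<Sum>x\<in>Poly_Mapping.keys f. Poly_Mapping.single x (Poly_Mapping.lookup f x))"
  by (rule poly_mapping_eqI)
    (auto simp: lookup_sum lookup_single when_def in_keys_iff)

lemma single_add_induct [case_names zero single add]:
  fixes f :: "'a \<Rightarrow>\<^sub>0 'k::comm_monoid_add"
  assumes "P 0" "\<And>x c. x \<in> Poly_Mapping.keys f \<Longrightarrow> P (Poly_Mapping.single x c)"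
    "\<And>a b. P a \<Longrightarrow> P b \<Longrightarrow> P (a + b)"
  shows "P f"
proof -
  have "P (\<Sum>x\<in>A. Poly_Mapping.single x (Poly_Mapping.lookup f x))"
    if "A \<subseteq> Poly_Mapping.keys f" for A
    using finite_subset[OF that finite_keys] that
    by (induction A rule: finite_induct) (auto intro: assms)
  from this[OF subset_refl] show ?thesis
    by (subst poly_mapping_sum_single)
qed

lemma pscale_mult_right: "a * pscale c b = pscale c (a * b)"
  for a b :: "'a::monoid_add \<Rightarrow>\<^sub>0 'k::field"
proof (induction a rule: single_add_induct)
  case (single w d)
  show ?case
    by (induction b rule: single_add_induct)
      (simp_all add: mult_single pscale_add distrib_left mult.left_commute)
qed (simp_all add: distrib_right pscale_add)

lemma lin_ext_superset:
  assumes "finite A" "Poly_Mapping.keys f \<subseteq> A"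
  shows "lin_ext u f = (\<Sum>x\<in>A. pscale (Poly_Mapping.lookup f x) (u x))"
  unfolding lin_ext_def by (rule sum.mono_neutral_left) (use assms in \<open>auto simp: in_keys_iff\<close>)

lemma lin_ext_zero [simp]: "lin_ext u 0 = 0"
  by (simp add: lin_ext_def)

lemma lin_ext_single [simp]: "lin_ext u (Poly_Mapping.single x c) = pscale c (u x)"
  by (subst lin_ext_superset[of "{x}"]) auto

lemma lin_ext_add: "lin_ext u (f + g) = lin_ext u f + lin_ext u g"
proof -
  let ?A = "Poly_Mapping.keys f \<union> Poly_Mapping.keys g"
  have "Poly_Mapping.keys (f + g) \<subseteq> ?A" by (rule keys_add)
  then show ?thesis
    by (simp add: lin_ext_superset[of ?A] lookup_add pscale_add_left sum.distrib)
qed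

lemma lin_ext_scale: "lin_ext u (pscale c f) = pscale c (lin_ext u f)"
proof -
  have "lin_ext u (pscale c f)
      = (\<Sum>x\<in>Poly_Mapping.keys f. pscale (Poly_Mapping.lookup (pscale c f) x) (u x))"
    by (rule lin_ext_superset) (simp_all add: keys_pscale)
  then show ?thesis by (simp add: lin_ext_def pscale_sum)
qed

lemma lin_ext_uminus: "lin_ext u (- f) = - lin_ext u f"
  by (metis lin_ext_scale pscale_minus_one)

lemma lin_ext_diff: "lin_ext u (f - g) = lin_ext u f - lin_ext u g"
  by (metis diff_conv_add_uminus lin_ext_add lin_ext_uminus)

lemma lin_ext_sum: "lin_ext u (\<Sum>x\<in>A. f x) = (\<Sum>x\<in>A. lin_ext u (f x))"
  by (induction A rule: infinite_finite_induct) (simp_all add: lin_ext_add)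

lemma keys_sum_subset:
  assumes "\<And>x. x \<in> A \<Longrightarrow> Poly_Mapping.keys (f x) \<subseteq> B"
  shows "Poly_Mapping.keys (\<Sum>x\<in>A. f x) \<subseteq> B"
  using assms
proof (induction A rule: infinite_finite_induct)
  case (insert x A)
  then have "Poly_Mapping.keys (f x) \<subseteq> B" "Poly_Mapping.keys (\<Sum>x\<in>A. f x) \<subseteq> B" by auto
  with insert.hyps show ?case using keys_add[of "f x" "\<Sum>x\<in>A. f x"] by auto
qed auto

lemma keys_lin_ext:
  assumes "\<And>x. x \<in> Poly_Mapping.keys f \<Longrightarrow> Poly_Mapping.keys (u x) \<subseteq> B"
  shows "Poly_Mapping.keys (lin_ext u f) \<subseteq> B"
  unfolding lin_ext_def by (rule keys_sum_subset) (use assms keys_pscale in fastforce)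


subsection \<open>The Leavitt path algebra is an algebra\<close>

lemma gen_closed: "g \<in> lgens Q \<Longrightarrow> gen g \<in> free_carrier Q"
  by (simp add: gen_def free_carrier_def)

lemma free_zero: "0 \<in> free_carrier Q"
  by (simp add: free_carrier_def)

lemma free_add: "a \<in> free_carrier Q \<Longrightarrow> b \<in> free_carrier Q \<Longrightarrow> a + b \<in> free_carrier Q"
  unfolding free_carrier_def using keys_add[of a b] by blast

lemma free_scale: "a \<in> free_carrier Q \<Longrightarrow> pscale c a \<in> free_carrier Q"
  unfolding free_carrier_def using keys_pscale[of c a] by blast

lemma free_mult: "a \<in> free_carrier Q \<Longrightarrow> b \<in> free_carrier Q \<Longrightarrow> a * b \<in> free_carrier Q"
  unfolding free_carrier_def using keys_mult[of a b] by (fastforce simp: plus_gword_def)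

lemma free_uminus: "a \<in> free_carrier Q \<Longrightarrow> - a \<in> free_carrier Q"
  by (metis free_scale pscale_minus_one)

lemma free_diff: "a \<in> free_carrier Q \<Longrightarrow> b \<in> free_carrier Q \<Longrightarrow> a - b \<in> free_carrier Q"
  by (metis diff_conv_add_uminus free_add free_uminus)

lemma free_sum: "(\<And>x. x \<in> A \<Longrightarrow> f x \<in> free_carrier Q) \<Longrightarrow> (\<Sum>x\<in>A. f x) \<in> free_carrier Q"
  by (induction A rule: infinite_finite_induct) (simp_all add: free_zero free_add)

lemma ideal_uminus: "a \<in> leavitt_ideal Q \<Longrightarrow> - a \<in> leavitt_ideal Q"
  by (metis leavitt_ideal.scale pscale_minus_one)

lemma ideal_diff: "a \<in> leavitt_ideal Q \<Longrightarrow> b \<in> leavitt_ideal Q \<Longrightarrow> a - b \<in> leavitt_ideal Q"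
  by (metis diff_conv_add_uminus leavitt_ideal.add ideal_uminus)

lemma leavitt_relations_free:
  assumes "wf_digraph Q" "r \<in> leavitt_relations Q"
  shows "r \<in> free_carrier Q"
proof -
  interpret wf_digraph Q by fact
  show ?thesis
    using assms(2)
    by cases (auto intro!: free_diff free_mult free_sum gen_closed free_zero
        simp: lgens_def regular_vertex_def)
qed

lemma leavitt_ideal_free:
  assumes "wf_digraph Q" "a \<in> leavitt_ideal Q"
  shows "a \<in> free_carrier Q"
  using assms(2)
  by induction
    (auto intro: leavitt_relations_free[OF assms(1)] free_zero free_add free_scale free_mult)

lemma mem_lcoset: "b \<in> lcoset Q a \<longleftrightarrow> b - a \<in> leavitt_ideal Q"
  unfolding lcoset_def by (auto simp: image_iff algebra_simps intro: bexI[of _ "b - a"])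

lemma lcoset_eq_iff: "lcoset Q a = lcoset Q b \<longleftrightarrow> a - b \<in> leavitt_ideal Q"
proof
  assume "lcoset Q a = lcoset Q b"
  then show "a - b \<in> leavitt_ideal Q"
    using mem_lcoset[of a Q a] by (simp add: leavitt_ideal.zero mem_lcoset)
next
  assume *: "a - b \<in> leavitt_ideal Q"
  have "x - a \<in> leavitt_ideal Q \<longleftrightarrow> x - b \<in> leavitt_ideal Q" for x
    using leavitt_ideal.add[OF _ *, of "x - a"] ideal_diff[OF _ *, of "x - b"] by auto
  then show "lcoset Q a = lcoset Q b" by (auto simp: mem_lcoset)
qed

lemma lcoset_self: "a \<in> lcoset Q a"
  by (simp add: mem_lcoset leavitt_ideal.zero)

lemma lcoset_nonempty: "lcoset Q a \<noteq> {}"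
  using lcoset_self by blast

lemma lcoset_free:
  assumes "wf_digraph Q" "a \<in> free_carrier Q" "b \<in> lcoset Q a"
  shows "b \<in> free_carrier Q"
  using free_add[OF leavitt_ideal_free[OF assms(1), of "b - a"] assms(2)] assms(3)
  by (simp add: mem_lcoset)

lemma leavitt_carrier: "vcarrier (leavitt_path_algebra Q) = lcoset Q ` free_carrier Q"
  by (simp add: leavitt_path_algebra_def)

lemma leavitt_zero: "vzero (leavitt_path_algebra Q) = lcoset Q 0"
  by (simp add: leavitt_path_algebra_def)

lemma leavitt_add:
  "vadd (leavitt_path_algebra Q) (lcoset Q a) (lcoset Q b) = lcoset Q (a + b)"
proof -
  have "lcoset Q (a' + b') = lcoset Q (a + b)" if "a' \<in> lcoset Q a" "b' \<in> lcoset Q b" for a' b'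
    using leavitt_ideal.add[of "a' - a" Q "b' - b"] that
    by (simp add: lcoset_eq_iff mem_lcoset algebra_simps)
  then show ?thesis
    by (auto simp: leavitt_path_algebra_def lcoset_nonempty)
qed

lemma leavitt_scale:
  "vscale (leavitt_path_algebra Q) c (lcoset Q a) = lcoset Q (pscale c a)"
proof -
  have "lcoset Q (pscale c a') = lcoset Q (pscale c a)" if "a' \<in> lcoset Q a" for a'
    using leavitt_ideal.scale[of "a' - a" Q c] that
    by (simp add: lcoset_eq_iff mem_lcoset pscale_diff)
  then show ?thesis
    by (auto simp: leavitt_path_algebra_def lcoset_nonempty)
qed

lemma leavitt_mult:
  assumes "wf_digraph Q" "a \<in> free_carrier Q" "b \<in> free_carrier Q"
  shows "amult (leavitt_path_algebra Q) (lcoset Q a) (lcoset Q b) = lcoset Q (a * b)"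
proof -
  have "lcoset Q (a' * b') = lcoset Q (a * b)" if "a' \<in> lcoset Q a" "b' \<in> lcoset Q b" for a' b'
  proof -
    have "a' * (b' - b) + (a' - a) * b \<in> leavitt_ideal Q"
      using that assms lcoset_free[OF assms(1,2) that(1)]
      by (intro leavitt_ideal.add leavitt_ideal.mult_left leavitt_ideal.mult_right)
        (auto simp: mem_lcoset)
    then show ?thesis by (simp add: lcoset_eq_iff algebra_simps)
  qed
  then show ?thesis
    by (auto simp: leavitt_path_algebra_def lcoset_nonempty)
qed

lemma kalgebra_leavitt_path_algebra:
  assumes "wf_digraph Q"
  shows "kalgebra (leavitt_path_algebra Q)"
  by unfold_locales
    (auto simp: leavitt_carrier leavitt_zero leavitt_add leavitt_scale leavitt_mult[OF assms]
      free_zero free_add free_scale free_mult add.assoc add.commute add.left_commute mult.assoc distrib_left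
      distrib_right pscale_add pscale_add_left pscale_mult_left pscale_mult_right
      intro!: imageI rev_bexI[OF free_uminus])


subsection \<open>The associated representation is a representation\<close>

lemma kspace_assoc_space:
  "kspace (assoc_space X :: ('k::field, 'x \<Rightarrow>\<^sub>0 'k) vspace)"
proof
  fix x :: "'x \<Rightarrow>\<^sub>0 'k" assume "x \<in> vcarrier (assoc_space X)"
  then show "\<exists>y\<in>vcarrier (assoc_space X). vadd (assoc_space X) x y = vzero (assoc_space X)"
    using keys_pscale[of "- 1" x]
    by (intro bexI[of _ "- x"]) (auto simp: assoc_space_def pscale_minus_one)
next
  fix x y :: "'x \<Rightarrow>\<^sub>0 'k" assume "x \<in> vcarrier (assoc_space X)" "y \<in> vcarrier (assoc_space X)"
  then show "vadd (assoc_space X) x y \<in> vcarrier (assoc_space X)"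
    using keys_add[of x y] by (auto simp: assoc_space_def)
next
  fix x :: "'x \<Rightarrow>\<^sub>0 'k" and c :: 'k assume "x \<in> vcarrier (assoc_space X)"
  then show "vscale (assoc_space X) c x \<in> vcarrier (assoc_space X)"
    using keys_pscale[of c x] by (auto simp: assoc_space_def)
qed (auto simp: assoc_space_def ac_simps pscale_add pscale_add_left)

lemma lin_ext_add_fun: "lin_ext (\<lambda>x. u x + v x) f = lin_ext u f + lin_ext v f"
  by (simp add: lin_ext_def pscale_add sum.distrib)

lemma lin_ext_scale_fun: "lin_ext (\<lambda>x. pscale c (u x)) f = pscale c (lin_ext u f)"
  by (simp add: lin_ext_def pscale_sum mult.commute)

lemma word_act_add: "word_act Q X w (f + g) = word_act Q X w f + word_act Q X w g"
proof -
  have "foldr (\<lambda>g. lin_ext (basis_act Q X g)) gs (f + g)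
      = foldr (\<lambda>g. lin_ext (basis_act Q X g)) gs f + foldr (\<lambda>g. lin_ext (basis_act Q X g)) gs g"
    for gs by (induction gs) (simp_all add: lin_ext_add)
  then show ?thesis by (simp add: word_act_def)
qed

lemma word_act_scale: "word_act Q X w (pscale c f) = pscale c (word_act Q X w f)"
proof -
  have "foldr (\<lambda>g. lin_ext (basis_act Q X g)) gs (pscale c f)
      = pscale c (foldr (\<lambda>g. lin_ext (basis_act Q X g)) gs f)"
    for gs by (induction gs) (simp_all add: lin_ext_scale)
  then show ?thesis by (simp add: word_act_def)
qed

lemma word_act_zero: "word_act Q X w 0 = 0"
  using word_act_scale[of Q X w 0 0] by simp

lemma word_act_plus: "word_act Q X (v + w) f = word_act Q X v (word_act Q X w f)"
  by (simp add: word_act_def plus_gword_def)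

lemma free_act_add: "free_act Q X a (f + g) = free_act Q X a f + free_act Q X a g"
  by (simp add: free_act_def word_act_add lin_ext_add_fun)

lemma free_act_scale: "free_act Q X a (pscale c f) = pscale c (free_act Q X a f)"
  by (simp add: free_act_def word_act_scale lin_ext_scale_fun)

lemma free_act_zero: "free_act Q X a 0 = 0"
  using free_act_scale[of Q X a 0 0] by simp

lemma free_act_add_left: "free_act Q X (a + b) f = free_act Q X a f + free_act Q X b f"
  and free_act_diff_left: "free_act Q X (a - b) f = free_act Q X a f - free_act Q X b f"
  and free_act_scale_left: "free_act Q X (pscale c a) f = pscale c (free_act Q X a f)"
  and free_act_sum_left: "free_act Q X (\<Sum>x\<in>A. h x) f = (\<Sum>x\<in>A. free_act Q X (h x) f)"
  and free_act_zero_left: "free_act Q X 0 f = 0"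
  by (simp_all add: free_act_def lin_ext_add lin_ext_diff lin_ext_scale lin_ext_sum)

lemma free_act_single:
  "free_act Q X (Poly_Mapping.single w c) f = pscale c (word_act Q X w f)"
  by (simp add: free_act_def)

lemma free_act_gen: "free_act Q X (gen g) f = lin_ext (basis_act Q X g) f"
  by (simp add: gen_def free_act_single word_act_def)

lemma free_act_mult: "free_act Q X (a * b) f = free_act Q X a (free_act Q X b f)"
proof (induction a rule: single_add_induct)
  case (single w c)
  show ?case
    by (induction b rule: single_add_induct)
      (simp_all add: mult_single free_act_single free_act_zero free_act_zero_left free_act_add
        free_act_add_left word_act_plus word_act_scale word_act_add word_act_zero distrib_left
        pscale_add)
qed (simp_all add: free_act_zero_left free_act_add_left distrib_right)

context branching_system
begin

lemma keys_basis_act: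
  assumes "g \<in> lgens Q"
  shows "Poly_Mapping.keys (basis_act Q X g x) \<subseteq> points X"
proof (cases g)
  case (Vert i)
  then show ?thesis using assms vset_points[of i] by (auto simp: lgens_def)
next
  case (Arr \<alpha>)
  then have \<alpha>: "\<alpha> \<in> arcs Q" using assms by (auto simp: lgens_def)
  have "inv_into (vset X (head Q \<alpha>)) (sig X \<alpha>) x \<in> vset X (head Q \<alpha>)" if "x \<in> aset X \<alpha>"
    using that bij_betw_imp_surj_on[OF sig_bij[OF \<alpha>]] by (auto intro: inv_into_into)
  then show ?thesis using Arr \<alpha> vset_points[of "head Q \<alpha>"] by auto
next
  case (Ghost \<alpha>)
  then have \<alpha>: "\<alpha> \<in> arcs Q" using assms by (auto simp: lgens_def)
  show ?thesis using Ghost bij_betw_apply[OF sig_bij[OF \<alpha>]] aset_points[OF \<alpha>] by auto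
qed

lemma keys_word_act:
  assumes "set (letters w) \<subseteq> lgens Q" "Poly_Mapping.keys f \<subseteq> points X"
  shows "Poly_Mapping.keys (word_act Q X w f) \<subseteq> points X"
proof -
  have "Poly_Mapping.keys (foldr (\<lambda>g. lin_ext (basis_act Q X g)) gs f) \<subseteq> points X"
    if "set gs \<subseteq> lgens Q" for gs
    using that by (induction gs) (auto simp: assms(2) intro!: keys_lin_ext dest!: set_mp[OF keys_basis_act]
      dest: subsetD[OF assms(2)])
  then show ?thesis using assms by (simp add: word_act_def)
qed

lemma keys_free_act:
  assumes "a \<in> free_carrier Q" "Poly_Mapping.keys f \<subseteq> points X"
  shows "Poly_Mapping.keys (free_act Q X a f) \<subseteq> points X"
  unfolding free_act_def
  by (rule keys_lin_ext, rule keys_word_act) (use assms in \<open>auto simp: free_carrier_def\<close>)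

lemma relations_act_single:
  assumes "r \<in> leavitt_relations Q"
  shows "free_act Q X r (Poly_Mapping.single x c) = 0"
  using assms
proof cases
  case (orth i j)
  then show ?thesis using vset_disjoint[of i j]
    by (auto simp: free_act_diff_left free_act_mult free_act_gen free_act_zero_left)
next
  case (head_arr \<alpha>)
  have "inv_into (vset X (head Q \<alpha>)) (sig X \<alpha>) x \<in> vset X (head Q \<alpha>)" if "x \<in> aset X \<alpha>"
    using that bij_betw_imp_surj_on[OF sig_bij[OF head_arr(2)]] by (auto intro: inv_into_into)
  then show ?thesis using head_arr
    by (auto simp: free_act_diff_left free_act_mult free_act_gen)
next
  case (arr_tail \<alpha>)
  then show ?thesis using aset_vset[of \<alpha>]
    by (auto simp: free_act_diff_left free_act_mult free_act_gen)
next
  case (tail_ghost \<alpha>)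
  then show ?thesis using aset_vset[of \<alpha>] bij_betw_apply[OF sig_bij[of \<alpha>], of x]
    by (auto simp: free_act_diff_left free_act_mult free_act_gen)
next
  case (ghost_head \<alpha>)
  then show ?thesis
    by (auto simp: free_act_diff_left free_act_mult free_act_gen)
next
  case (arr_ghost \<alpha> \<beta>)
  then show ?thesis
    using aset_disjoint[of \<alpha> \<beta>] bij_betw_apply[OF sig_bij[of \<beta>], of x]
      bij_betw_inv_into_left[OF sig_bij[of \<beta>], of x]
    by (auto simp: free_act_diff_left free_act_mult free_act_gen free_act_zero_left)
next
  case (ghost_arr i)
  have "free_act Q X (gen (Ghost \<alpha>) * gen (Arr \<alpha>)) (Poly_Mapping.single x c)
      = (if x \<in> aset X \<alpha> then Poly_Mapping.single x c else 0)" if "\<alpha> \<in> out_arcs Q i" for \<alpha>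
  proof -
    have "bij_betw (sig X \<alpha>) (vset X (head Q \<alpha>)) (aset X \<alpha>)"
      using that sig_bij by simp
    then show ?thesis
      using bij_betw_inv_into_right[of "sig X \<alpha>" "vset X (head Q \<alpha>)" "aset X \<alpha>" x]
        bij_betw_apply[OF bij_betw_inv_into, of "sig X \<alpha>" "vset X (head Q \<alpha>)" "aset X \<alpha>" x]
      by (auto simp: free_act_mult free_act_gen)
  qed
  then have *: "free_act Q X r (Poly_Mapping.single x c)
      = (\<Sum>\<alpha>\<in>out_arcs Q i. if x \<in> aset X \<alpha> then Poly_Mapping.single x c else 0)
        - (if x \<in> vset X i then Poly_Mapping.single x c else 0)"
    by (simp add: ghost_arr(1) free_act_diff_left free_act_sum_left free_act_gen)
  have fin: "finite (out_arcs Q i)"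
    using ghost_arr(2) by (auto simp: regular_vertex_def infinite_emitter_def)
  show ?thesis
  proof (cases "x \<in> vset X i")
    case True
    then obtain \<alpha> where \<alpha>: "\<alpha> \<in> out_arcs Q i" "x \<in> aset X \<alpha>"
      using vset_regular[OF ghost_arr(2)] by auto
    then have "x \<in> aset X \<beta> \<longleftrightarrow> \<beta> = \<alpha>" if "\<beta> \<in> out_arcs Q i" for \<beta>
      using that aset_disjoint[of \<alpha> \<beta>] by auto
    then have "(\<Sum>\<beta>\<in>out_arcs Q i. if x \<in> aset X \<beta> then Poly_Mapping.single x c else 0)
        = (\<Sum>\<beta>\<in>out_arcs Q i. if \<beta> = \<alpha> then Poly_Mapping.single x c else 0)"
      by (intro sum.cong) auto
    with True \<alpha>(1) fin show ?thesis by (simp add: *)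
  next
    case False
    then show ?thesis using vset_regular[OF ghost_arr(2)] by (auto simp: * intro!: sum.neutral)
  qed
qed

lemma relations_act: "r \<in> leavitt_relations Q \<Longrightarrow> free_act Q X r f = 0"
  by (induction f rule: single_add_induct)
    (simp_all add: free_act_zero free_act_add relations_act_single)

lemma ideal_act: "a \<in> leavitt_ideal Q \<Longrightarrow> free_act Q X a f = 0"
  by (induction arbitrary: f rule: leavitt_ideal.induct)
    (simp_all add: relations_act free_act_zero_left free_act_add_left free_act_scale_left
      free_act_mult free_act_zero)

lemma assoc_rep_lcoset:
  "assoc_rep Q X (lcoset Q a) = (\<lambda>f\<in>vcarrier (assoc_space X). free_act Q X a f)"
proof -
  have "(SOME b. b \<in> lcoset Q a) - a \<in> leavitt_ideal Q"
    using someI[of "\<lambda>b. b \<in> lcoset Q a", OF lcoset_self] by (simp only: mem_lcoset)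
  from ideal_act[OF this] show ?thesis
    by (simp add: assoc_rep_def free_act_diff_left fun_eq_iff)
qed

lemma assoc_rep_gen:
  assumes "x \<in> points X"
  shows "assoc_rep Q X (lcoset Q (gen g)) (Poly_Mapping.single x 1) = basis_act Q X g x"
  using assms by (simp add: assoc_rep_lcoset free_act_gen assoc_space_def)

theorem representation_assoc_rep:
  "representation (leavitt_path_algebra Q) (assoc_space X) (assoc_rep Q X)"
proof -
  have M: "free_act Q X a f \<in> vcarrier (assoc_space X)"
    if "a \<in> free_carrier Q" "f \<in> vcarrier (assoc_space X)" for a f
    using that keys_free_act by (simp add: assoc_space_def)
  have op: "vadd (assoc_space X) = (+)" "vscale (assoc_space X) = pscale"
    by (simp_all add: assoc_space_def)
  note cl = kspace.add_closed[OF kspace_assoc_space[of X], unfolded op]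
    kspace.scale_closed[OF kspace_assoc_space[of X], unfolded op]
  show ?thesis
    unfolding representation_def alg_hom_def
    by (auto simp: kspace_assoc_space leavitt_carrier leavitt_add leavitt_scale
        leavitt_mult[OF wf_digraph] assoc_rep_lcoset End_alg_def op cl M free_act_add
        free_act_scale free_act_add_left free_act_scale_left free_act_mult compose_def)
qed

end


subsection \<open>The standard branching systems are perfect\<close>

context wf_digraph
begin

lemma left_infinite_path_SCons:
  "left_infinite_path G (\<alpha> ## q) \<longleftrightarrow>
     \<alpha> \<in> arcs G \<and> head G \<alpha> = tail G (shd q) \<and> left_infinite_path G q"
proof
  assume L: "left_infinite_path G (\<alpha> ## q)"
  show "\<alpha> \<in> arcs G \<and> head G \<alpha> = tail G (shd q) \<and> left_infinite_path G q"
    using L[unfolded left_infinite_path_def, rule_format, of 0]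
      L[unfolded left_infinite_path_def, rule_format, of "Suc _"]
    by (auto simp: left_infinite_path_def)
next
  assume R: "\<alpha> \<in> arcs G \<and> head G \<alpha> = tail G (shd q) \<and> left_infinite_path G q"
  have "(\<alpha> ## q) !! n \<in> arcs G \<and> head G ((\<alpha> ## q) !! n) = tail G ((\<alpha> ## q) !! Suc n)" for n
    using R by (cases n) (auto simp: left_infinite_path_def)
  then show "left_infinite_path G (\<alpha> ## q)" by (simp add: left_infinite_path_def)
qed

lemma tail_equivalent_SCons: "tail_equivalent p (\<alpha> ## q) \<longleftrightarrow> tail_equivalent p q"
proof
  assume "tail_equivalent p (\<alpha> ## q)"
  then obtain n m where "sdrop n p = sdrop m (\<alpha> ## q)" by (auto simp: tail_equivalent_def)
  then have "sdrop (Suc n) p = sdrop m q"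
    by (metis sdrop_simps(2) sdrop_stl stream.sel(2))
  then show "tail_equivalent p q" unfolding tail_equivalent_def by blast
next
  assume "tail_equivalent p q"
  then obtain n m where "sdrop n p = sdrop m q" by (auto simp: tail_equivalent_def)
  then have "sdrop n p = sdrop (Suc m) (\<alpha> ## q)" by simp
  then show "tail_equivalent p (\<alpha> ## q)" unfolding tail_equivalent_def by blast
qed

lemma left_infinite_path_shd: "left_infinite_path G q \<Longrightarrow> shd q \<in> arcs G"
  unfolding left_infinite_path_def by (metis snth.simps(1))

lemma branching_system_tail_bs: "branching_system G (tail_bs G p)"
proof
  fix \<alpha> assume \<alpha>: "\<alpha> \<in> arcs G"
  show "bij_betw (sig (tail_bs G p) \<alpha>) (vset (tail_bs G p) (head G \<alpha>)) (aset (tail_bs G p) \<alpha>)"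
  proof (rule bij_betw_imageI)
    show "sig (tail_bs G p) \<alpha> ` vset (tail_bs G p) (head G \<alpha>) = aset (tail_bs G p) \<alpha>"
    proof (intro equalityI subsetI)
      fix q assume q: "q \<in> aset (tail_bs G p) \<alpha>"
      obtain q' where "q = \<alpha> ## q'"
        using q by (cases q) (auto simp: tail_bs_def)
      then show "q \<in> sig (tail_bs G p) \<alpha> ` vset (tail_bs G p) (head G \<alpha>)" using q
        by (auto simp: tail_bs_def Let_def left_infinite_path_SCons tail_equivalent_SCons)
    qed (auto simp: tail_bs_def \<alpha> left_infinite_path_SCons tail_equivalent_SCons)
  qed (simp add: tail_bs_def inj_on_def Let_def)
qed (auto simp: tail_bs_def Let_def dest: left_infinite_path_shd)

lemma perfect_bs_tail_bs: "perfect_bs G (tail_bs G p)"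
  by (auto simp: perfect_bs_def saturated_bs_def tail_bs_def Let_def
      intro: tail_in_verts dest: left_infinite_path_shd)

lemma awalk_Cons_conv: "awalk u (\<alpha> # w) i \<longleftrightarrow> \<alpha> \<in> arcs G \<and> u = tail G \<alpha> \<and> awalk (head G \<alpha>) w i"
  by (auto simp: awalk_def)

lemma sink_bs_vset:
  assumes "sink G i" "j \<in> verts G" "\<not> sink G j"
  shows "vset (sink_bs G i) j = (\<Union>\<alpha>\<in>out_arcs G j. aset (sink_bs G i) \<alpha>)"
proof -
  have "w \<noteq> [] \<and> hd w \<in> out_arcs G u" if "awalk u w i" "u = j" for u w
    using that assms by (cases w) (auto simp: awalk_def awalk_Cons_conv)
  moreover have "u = tail G (hd w)" if "awalk u w i" "w \<noteq> []" for u w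
    using that by (cases w) (auto simp: awalk_Cons_conv)
  ultimately show ?thesis by (auto simp: sink_bs_def Let_def; blast)
qed

lemma branching_system_sink_bs:
  assumes "sink G i"
  shows "branching_system G (sink_bs G i)"
proof
  fix \<alpha> assume \<alpha>: "\<alpha> \<in> arcs G"
  show "bij_betw (sig (sink_bs G i) \<alpha>) (vset (sink_bs G i) (head G \<alpha>)) (aset (sink_bs G i) \<alpha>)"
  proof (rule bij_betw_imageI)
    show "sig (sink_bs G i) \<alpha> ` vset (sink_bs G i) (head G \<alpha>) = aset (sink_bs G i) \<alpha>"
    proof (intro equalityI subsetI)
      fix q assume q: "q \<in> aset (sink_bs G i) \<alpha>"
      obtain w where w: "q = (tail G \<alpha>, \<alpha> # w)" "awalk (head G \<alpha>) w i"
        using q by (cases q; cases "snd q") (auto simp: sink_bs_def awalk_Cons_conv)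
      then show "q \<in> sig (sink_bs G i) \<alpha> ` vset (sink_bs G i) (head G \<alpha>)"
        by (auto simp: sink_bs_def Let_def image_iff)
    qed (auto simp: sink_bs_def \<alpha> awalk_Cons_conv)
  qed (auto simp: sink_bs_def inj_on_def)
  show "aset (sink_bs G i) \<alpha> \<subseteq> vset (sink_bs G i) (tail G \<alpha>)"
  proof
    fix q assume "q \<in> aset (sink_bs G i) \<alpha>"
    then show "q \<in> vset (sink_bs G i) (tail G \<alpha>)"
      by (cases q; cases "snd q") (auto simp: sink_bs_def awalk_Cons_conv)
  qed
next
  fix j assume "regular_vertex G j"
  then show "vset (sink_bs G i) j = (\<Union>\<alpha>\<in>out_arcs G j. aset (sink_bs G i) \<alpha>)"
    using sink_bs_vset[OF assms] by (auto simp: regular_vertex_def)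
qed (auto simp: sink_bs_def Let_def)

lemma perfect_bs_sink_bs: "sink G i \<Longrightarrow> perfect_bs G (sink_bs G i)"
  using sink_bs_vset by (auto simp: perfect_bs_def saturated_bs_def)
    (auto simp: sink_bs_def awalk_def)

end

end

theory Submission imports Defs
begin

text \<open>Every point of a perfect system has an itinerary: it stops at a sink or runs forever. Sets
  closed under all \<open>\<sigma>\<^sub>\<alpha>\<close> and their inverses span subrepresentations, and the kernel of the linear
  map induced by a morphism of perfect systems is one. Hence irreducibility of \<open>M(X)\<close> makes
  \<open>X\<close> a single orbit on which such morphisms are injective. If some point \<open>z\<close> lies over a sink
  \<open>i\<close>, then applying paths to \<open>z\<close> identifies \<open>N\<^sub>i\<close> with \<open>X\<close>; otherwise the itinerary map
  identifies \<open>X\<close> with \<open>[p]\<close>. Conversely, in \<open>[p]\<close> and \<open>N\<^sub>i\<close> distinct points have distinct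
  itineraries, so a nonzero element of a subrepresentation with support of least size is a multiple
  of some \<open>\<chi>\<^sub>x\<close>: any arrow that does not kill it must preserve its support size.\<close>

section \<open>Calculus of linear extensions\<close>

lemma lin_ext_cong:
  "(\<And>x. x \<in> Poly_Mapping.keys f \<Longrightarrow> u x = v x) \<Longrightarrow> lin_ext u f = lin_ext v f"
  by (simp add: lin_ext_def)

lemma lin_ext_lin_ext: "lin_ext u (lin_ext v f) = lin_ext (\<lambda>x. lin_ext u (v x)) f"
proof -
  have "lin_ext u (lin_ext v f)
      = (\<Sum>x\<in>Poly_Mapping.keys f. lin_ext u (pscale (Poly_Mapping.lookup f x) (v x)))"
    unfolding lin_ext_def[of v] by (rule lin_ext_sum)
  then show ?thesis by (simp add: lin_ext_scale lin_ext_def[of "\<lambda>x. lin_ext u (v x)"])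
qed

lemma lookup_lin_ext:
  "Poly_Mapping.lookup (lin_ext u f) y
    = (\<Sum>x\<in>Poly_Mapping.keys f. Poly_Mapping.lookup f x * Poly_Mapping.lookup (u x) y)"
  by (simp add: lin_ext_def lookup_sum)

lemma single_one_nonzero: "Poly_Mapping.single x (1 :: 'k::field) \<noteq> 0"
proof
  assume "Poly_Mapping.single x (1 :: 'k) = 0"
  then have "Poly_Mapping.lookup (Poly_Mapping.single x (1 :: 'k)) x = 0" by simp
  then show False by simp
qed

section \<open>Orbits and itineraries of a branching system\<close>

text \<open>The equivalence makes \<open>C\<close> stable under each \<sigma> and under its inverse.
  These are exactly the sets of points whose supported functions are stable under all arrows and
  ghost arrows.\<close>

definition orbit_closed :: "('v, 'e) pre_digraph \<Rightarrow> ('v, 'e, 'x) branching \<Rightarrow> 'x set \<Rightarrow> bool" where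
  "orbit_closed Q X C \<longleftrightarrow> C \<subseteq> points X \<and>
     (\<forall>\<alpha>\<in>arcs Q. \<forall>x\<in>vset X (head Q \<alpha>). sig X \<alpha> x \<in> C \<longleftrightarrow> x \<in> C)"

definition bs_connected :: "('v, 'e) pre_digraph \<Rightarrow> ('v, 'e, 'x) branching \<Rightarrow> bool" where
  "bs_connected Q X \<longleftrightarrow> (\<forall>C. orbit_closed Q X C \<longrightarrow> C \<noteq> {} \<longrightarrow> C = points X)"

text \<open>In a perfect system this is equality of itineraries in coinductive form: it treats
  finite and infinite itineraries alike and avoids constructing them.\<close>

definition bs_bisim ::
  "('v, 'e) pre_digraph \<Rightarrow> ('v, 'e, 'x) branching \<Rightarrow> ('x \<Rightarrow> 'x \<Rightarrow> bool) \<Rightarrow> bool" where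
  "bs_bisim Q X R \<longleftrightarrow> (\<forall>x y. R x y \<longrightarrow> x \<in> points X \<and> y \<in> points X \<and>
     (\<forall>i\<in>verts Q. x \<in> vset X i \<longrightarrow> y \<in> vset X i) \<and>
     (\<forall>\<alpha>\<in>arcs Q. \<forall>x'\<in>vset X (head Q \<alpha>). x = sig X \<alpha> x' \<longrightarrow>
        (\<exists>y'\<in>vset X (head Q \<alpha>). y = sig X \<alpha> y' \<and> R x' y')))"

text \<open>In a perfect system this says that a point is determined by its itinerary.\<close>

definition bs_separated :: "('v, 'e) pre_digraph \<Rightarrow> ('v, 'e, 'x) branching \<Rightarrow> bool" where
  "bs_separated Q X \<longleftrightarrow> (\<forall>R. bs_bisim Q X R \<longrightarrow> (\<forall>x y. R x y \<longrightarrow> x = y))"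

lemma bs_bisimD:
  assumes "bs_bisim Q X R" "R x y"
  shows "x \<in> points X" "y \<in> points X"
    and "\<And>i. i \<in> verts Q \<Longrightarrow> x \<in> vset X i \<Longrightarrow> y \<in> vset X i"
    and "\<And>\<alpha> x'. \<alpha> \<in> arcs Q \<Longrightarrow> x' \<in> vset X (head Q \<alpha>) \<Longrightarrow> x = sig X \<alpha> x' \<Longrightarrow>
      \<exists>y'\<in>vset X (head Q \<alpha>). y = sig X \<alpha> y' \<and> R x' y'"
  using assms(1)[unfolded bs_bisim_def, rule_format, OF assms(2)] by simp_all

lemma bs_morphismD:
  assumes "bs_morphism Q X Y f"
  shows "\<And>x. x \<in> points X \<Longrightarrow> f x \<in> points Y"
    and "\<And>i x. i \<in> verts Q \<Longrightarrow> x \<in> vset X i \<Longrightarrow> f x \<in> vset Y i"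
    and "\<And>\<alpha> x. \<alpha> \<in> arcs Q \<Longrightarrow> x \<in> aset X \<alpha> \<Longrightarrow> f x \<in> aset Y \<alpha>"
    and "\<And>\<alpha> x. \<alpha> \<in> arcs Q \<Longrightarrow> x \<in> vset X (head Q \<alpha>) \<Longrightarrow> f (sig X \<alpha> x) = sig Y \<alpha> (f x)"
  using assms by (auto simp: bs_morphism_def image_subset_iff)


section \<open>Subrepresentations of the associated representation\<close>

context branching_system
begin

lemma sig_mem: "\<alpha> \<in> arcs Q \<Longrightarrow> x \<in> vset X (head Q \<alpha>) \<Longrightarrow> sig X \<alpha> x \<in> aset X \<alpha>"
  using bij_betw_apply[OF sig_bij] .

lemma sig_inj:
  "\<alpha> \<in> arcs Q \<Longrightarrow> x \<in> vset X (head Q \<alpha>) \<Longrightarrow> y \<in> vset X (head Q \<alpha>)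
    \<Longrightarrow> sig X \<alpha> x = sig X \<alpha> y \<longleftrightarrow> x = y"
  using bij_betw_imp_inj_on[OF sig_bij[of \<alpha>]] by (simp add: inj_on_eq_iff)

lemma aset_E:
  assumes "\<alpha> \<in> arcs Q" "x \<in> aset X \<alpha>"
  obtains y where "y \<in> vset X (head Q \<alpha>)" "x = sig X \<alpha> y"
  using assms bij_betw_imp_surj_on[OF sig_bij[of \<alpha>]] by blast

lemma sig_inv:
  "\<alpha> \<in> arcs Q \<Longrightarrow> x \<in> vset X (head Q \<alpha>) \<Longrightarrow>
    inv_into (vset X (head Q \<alpha>)) (sig X \<alpha>) (sig X \<alpha> x) = x"
  using bij_betw_inv_into_left[OF sig_bij] .

lemma vset_unique: "x \<in> vset X i \<Longrightarrow> x \<in> vset X j \<Longrightarrow> i \<in> verts Q \<Longrightarrow> j \<in> verts Q \<Longrightarrow> i = j"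
  using vset_disjoint by blast

lemma aset_unique: "x \<in> aset X \<alpha> \<Longrightarrow> x \<in> aset X \<beta> \<Longrightarrow> \<alpha> \<in> arcs Q \<Longrightarrow> \<beta> \<in> arcs Q \<Longrightarrow> \<alpha> = \<beta>"
  using aset_disjoint by blast

text \<open>Disjointness of the arrow sets recovers the arrow, and injectivity of its bijection then
  recovers the point. So the first step of an itinerary is unique.\<close>

lemma sig_eq:
  assumes "\<alpha> \<in> arcs Q" "x \<in> vset X (head Q \<alpha>)" "\<beta> \<in> arcs Q" "y \<in> vset X (head Q \<beta>)"
    "sig X \<alpha> x = sig X \<beta> y"
  shows "\<alpha> = \<beta>" "x = y"
proof -
  show "\<alpha> = \<beta>"
    using aset_unique[OF sig_mem[OF assms(1,2)] _ assms(1,3)] sig_mem[OF assms(3,4)] assms(5) by simp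
  with assms show "x = y" using sig_inj by simp
qed

lemma sig_points: "\<alpha> \<in> arcs Q \<Longrightarrow> x \<in> vset X (head Q \<alpha>) \<Longrightarrow> sig X \<alpha> x \<in> points X"
  using sig_mem aset_points by blast

text \<open>Words act as composites of generators and elements of the free algebra as linear
  combinations of words, so invariance can be tested on generators. This removes the cosets from all
  later arguments.\<close>

lemma subrepresentation_iff:
  "subrepresentation (leavitt_path_algebra Q :: ('k::field, ('v, 'e, 'k) falg set) kalg)
      (assoc_space X) (assoc_rep Q X) U \<longleftrightarrow>
    vsubspace (assoc_space X) U \<and> (\<forall>g\<in>lgens Q. \<forall>f\<in>U. lin_ext (basis_act Q X g) f \<in> U)"
proof (intro iffI conjI ballI)
  fix g and f :: "'x \<Rightarrow>\<^sub>0 'k"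
  assume A: "subrepresentation (leavitt_path_algebra Q :: ('k::field, ('v, 'e, 'k) falg set) kalg)
      (assoc_space X) (assoc_rep Q X) U" and g: "g \<in> lgens Q" "f \<in> U"
  then have f: "f \<in> vcarrier (assoc_space X)" and
    "assoc_rep Q X (lcoset Q (gen g :: ('v, 'e, 'k) falg)) f \<in> U"
    by (auto simp: subrepresentation_def vsubspace_def leavitt_carrier gen_closed)
  then show "lin_ext (basis_act Q X g) f \<in> U" by (simp add: assoc_rep_lcoset free_act_gen)
next
  assume A: "vsubspace (assoc_space X) U \<and>
    (\<forall>g\<in>lgens Q. \<forall>f\<in>U. lin_ext (basis_act Q X g) f \<in> U)"
  then have U: "0 \<in> U" "\<And>x y. x \<in> U \<Longrightarrow> y \<in> U \<Longrightarrow> x + y \<in> U" "\<And>c x. x \<in> U \<Longrightarrow> pscale c x \<in> U"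
    "U \<subseteq> vcarrier (assoc_space X)"
    by (auto simp: vsubspace_def assoc_space_def)
  have "foldr (\<lambda>g. lin_ext (basis_act Q X g)) gs f \<in> U" if "f \<in> U" "set gs \<subseteq> lgens Q" for f gs
    using that(2) A that(1) by (induction gs) auto
  then have W: "word_act Q X w f \<in> U" if "f \<in> U" "set (letters w) \<subseteq> lgens Q" for f w
    using that by (simp add: word_act_def)
  have S: "(\<Sum>w\<in>A. h w) \<in> U" if "\<And>w. w \<in> A \<Longrightarrow> h w \<in> U" for A and h :: "('v, 'e) lgen gword \<Rightarrow> _"
    using that by (induction A rule: infinite_finite_induct) (auto intro: U)
  have "free_act Q X a f \<in> U" if "f \<in> U" "a \<in> free_carrier Q" for f a
    using that(2) by (auto simp: free_act_def lin_ext_def free_carrier_def intro!: S U(3) W that(1))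
  then show "subrepresentation (leavitt_path_algebra Q :: ('k::field, ('v, 'e, 'k) falg set) kalg)
      (assoc_space X) (assoc_rep Q X) U"
    using A U(4) by (auto simp: subrepresentation_def leavitt_carrier assoc_rep_lcoset)
qed (simp add: subrepresentation_def)

lemma irreducible_imp_nonempty:
  assumes "irreducible_representation
    (leavitt_path_algebra Q :: ('k::field, ('v, 'e, 'k) falg set) kalg)
    (assoc_space X) (assoc_rep Q X)"
  shows "points X \<noteq> {}"
  using assms by (auto simp: irreducible_representation_def assoc_space_def)

lemma irreducibleD:
  assumes "irreducible_representation
      (leavitt_path_algebra Q :: ('k::field, ('v, 'e, 'k) falg set) kalg)
      (assoc_space X) (assoc_rep Q X)"
    and "U \<subseteq> {f. Poly_Mapping.keys f \<subseteq> points X}" "(0 :: 'x \<Rightarrow>\<^sub>0 'k) \<in> U"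
    and "\<And>f g. f \<in> U \<Longrightarrow> g \<in> U \<Longrightarrow> f + g \<in> U" "\<And>c f. f \<in> U \<Longrightarrow> pscale c f \<in> U"
    and "\<And>g f. g \<in> lgens Q \<Longrightarrow> f \<in> U \<Longrightarrow> lin_ext (basis_act Q X g) f \<in> U"
  shows "U = {0} \<or> U = {f. Poly_Mapping.keys f \<subseteq> points X}"
proof -
  have "vsubspace (assoc_space X) U"
    using assms(2-5) by (auto simp: vsubspace_def assoc_space_def)
  then have "subrepresentation (leavitt_path_algebra Q :: ('k::field, ('v, 'e, 'k) falg set) kalg)
      (assoc_space X) (assoc_rep Q X) U"
    using assms(6) by (simp add: subrepresentation_iff)
  then show ?thesis
    using assms(1) by (auto simp: irreducible_representation_def assoc_space_def)
qed

text \<open>The functions supported on a nonempty orbit-closed set \<open>C\<close> form a nonzero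
  subrepresentation, hence the whole space. Testing on \<chi> of a point puts that point into
  \<open>C\<close>.\<close>

lemma irreducible_imp_connected:
  assumes irr: "irreducible_representation
    (leavitt_path_algebra Q :: ('k::field, ('v, 'e, 'k) falg set) kalg)
    (assoc_space X) (assoc_rep Q X)"
  shows "bs_connected Q X"
  unfolding bs_connected_def
proof (intro allI impI)
  fix C assume C: "orbit_closed Q X C" "C \<noteq> {}"
  define U where "U = {f :: 'x \<Rightarrow>\<^sub>0 'k. Poly_Mapping.keys f \<subseteq> C}"
  have sub: "C \<subseteq> points X" using C by (simp add: orbit_closed_def)
  have act: "Poly_Mapping.keys (basis_act Q X g x :: 'x \<Rightarrow>\<^sub>0 'k) \<subseteq> C" if "x \<in> C" "g \<in> lgens Q" for g x
  proof (cases g)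
    case (Arr \<alpha>)
    then have \<alpha>: "\<alpha> \<in> arcs Q" using that by (auto simp: lgens_def)
    show ?thesis
    proof (cases "x \<in> aset X \<alpha>")
      case True
      then obtain y where y: "y \<in> vset X (head Q \<alpha>)" "x = sig X \<alpha> y" using aset_E[OF \<alpha>] by metis
      \<comment> \<open>An arrow undoes \<sigma>, so this case needs closure under inverses; ghost
        arrows use the other direction.\<close>
      then have "y \<in> C" using C(1) \<alpha> that by (auto simp: orbit_closed_def)
      with y Arr \<alpha> show ?thesis by (simp add: sig_inv)
    qed (simp add: Arr)
  qed (use that C(1) in \<open>auto simp: orbit_closed_def lgens_def\<close>)
  have "U = {0} \<or> U = {f. Poly_Mapping.keys f \<subseteq> points X}"
  proof (rule irreducibleD[OF irr])
    show "f + g \<in> U" if "f \<in> U" "g \<in> U" for f g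
      using that keys_add[of f g] by (auto simp: U_def)
    show "pscale c f \<in> U" if "f \<in> U" for c f
      using that keys_pscale[of c f] by (auto simp: U_def)
    show "lin_ext (basis_act Q X g) f \<in> U" if "g \<in> lgens Q" "f \<in> U" for g f
      using that act by (auto simp: U_def intro!: keys_lin_ext dest!: subsetD)
  qed (use sub in \<open>auto simp: U_def\<close>)
  moreover obtain x where "x \<in> C" using C by blast
  then have "Poly_Mapping.single x 1 \<in> U" "Poly_Mapping.single x 1 \<noteq> (0 :: 'x \<Rightarrow>\<^sub>0 'k)"
    by (auto simp: U_def single_one_nonzero)
  ultimately have U: "U = {f. Poly_Mapping.keys f \<subseteq> points X}" by auto
  have "y \<in> C" if "y \<in> points X" for y
  proof -
    have "Poly_Mapping.single y 1 \<in> U" using that by (simp add: U)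
    then show ?thesis by (simp add: U_def)
  qed
  with sub show "C = points X" by blast
qed

text \<open>Together with the formula for arrows below, this makes supports computable: a vertex
  cuts the support down to its set, an arrow pulls it back along \<sigma>.\<close>

lemma lookup_act_Vert:
  "Poly_Mapping.lookup (lin_ext (basis_act Q X (Vert i)) f) y
    = (if y \<in> vset X i then Poly_Mapping.lookup f y else 0)"
proof -
  have "Poly_Mapping.lookup (lin_ext (basis_act Q X (Vert i)) f) y
    = (\<Sum>x\<in>Poly_Mapping.keys f. if x = y then (if y \<in> vset X i then Poly_Mapping.lookup f y else 0) else 0)"
    unfolding lookup_lin_ext by (rule sum.cong) (auto simp: lookup_single)
  then show ?thesis by (simp add: in_keys_iff)
qed

lemma lookup_act_Arr:
  fixes f :: "'x \<Rightarrow>\<^sub>0 'k::field"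
  assumes \<alpha>: "\<alpha> \<in> arcs Q"
  shows "Poly_Mapping.lookup (lin_ext (basis_act Q X (Arr \<alpha>)) f) y
    = (if y \<in> vset X (head Q \<alpha>) then Poly_Mapping.lookup f (sig X \<alpha> y) else 0)"
proof -
  \<comment> \<open>For fixed \<open>y\<close>, at most one basis vector contributes, namely that of
    \<open>sig X \<alpha> y\<close>; the sum over the support then collapses to one term.\<close>
  have "Poly_Mapping.lookup (basis_act Q X (Arr \<alpha>) x :: 'x \<Rightarrow>\<^sub>0 'k) y
      = (if x = sig X \<alpha> y then (if y \<in> vset X (head Q \<alpha>) then 1 else 0) else 0)" for x
  proof (cases "x \<in> aset X \<alpha>")
    case True
    then obtain z where "z \<in> vset X (head Q \<alpha>)" "x = sig X \<alpha> z" using aset_E[OF \<alpha>] by metis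
    with True \<alpha> show ?thesis using sig_inj[OF \<alpha>] by (auto simp: sig_inv lookup_single when_def)
  next
    case False
    then show ?thesis using sig_mem[OF \<alpha>] by auto
  qed
  then have "Poly_Mapping.lookup (lin_ext (basis_act Q X (Arr \<alpha>)) f) y
    = (\<Sum>x\<in>Poly_Mapping.keys f. if x = sig X \<alpha> y then
        (if y \<in> vset X (head Q \<alpha>) then Poly_Mapping.lookup f (sig X \<alpha> y) else 0) else 0)"
    unfolding lookup_lin_ext by (intro sum.cong) (auto simp del: basis_act.simps)
  then show ?thesis by (simp add: in_keys_iff)
qed

text \<open>Lying in the support of a common element of least support size is a bisimulation, so
  separation shrinks such a support to one point. Connectedness then carries this one basis vector
  to all others.\<close>

lemma connected_separated_imp_irreducible:
  assumes con: "bs_connected Q X" and sep: "bs_separated Q X" and ne: "points X \<noteq> {}"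
  shows "irreducible_representation
    (leavitt_path_algebra Q :: ('k::field, ('v, 'e, 'k) falg set) kalg)
    (assoc_space X) (assoc_rep Q X)"
  unfolding irreducible_representation_def
proof (intro conjI allI impI)
  show "representation (leavitt_path_algebra Q :: ('k, ('v, 'e, 'k) falg set) kalg)
    (assoc_space X) (assoc_rep Q X)" by (rule representation_assoc_rep)
  obtain x where "x \<in> points X" using ne by blast
  then have "Poly_Mapping.single x (1::'k) \<in> vcarrier (assoc_space X)"
    "Poly_Mapping.single x (1::'k) \<noteq> vzero (assoc_space X)"
    by (auto simp: assoc_space_def single_one_nonzero)
  then show "vcarrier (assoc_space X :: ('k, 'x \<Rightarrow>\<^sub>0 'k) vspace) \<noteq> {vzero (assoc_space X)}" by auto
  fix U assume "subrepresentation
    (leavitt_path_algebra Q :: ('k, ('v, 'e, 'k) falg set) kalg) (assoc_space X) (assoc_rep Q X) U"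
  then have "vsubspace (assoc_space X) U"
    and act: "\<And>g f. g \<in> lgens Q \<Longrightarrow> f \<in> U \<Longrightarrow> lin_ext (basis_act Q X g) f \<in> U"
    by (auto simp: subrepresentation_iff)
  then have U: "\<And>f. f \<in> U \<Longrightarrow> Poly_Mapping.keys f \<subseteq> points X" "0 \<in> U"
    "\<And>f g. f \<in> U \<Longrightarrow> g \<in> U \<Longrightarrow> f + g \<in> U" "\<And>c f. f \<in> U \<Longrightarrow> pscale c f \<in> U"
    by (auto simp: vsubspace_def assoc_space_def)
  show "U = {vzero (assoc_space X)} \<or> U = vcarrier (assoc_space X)"
  proof (cases "U = {0}")
    case False
    define minimal where "minimal f \<longleftrightarrow> f \<in> U \<and> f \<noteq> 0 \<and> (\<forall>g\<in>U. g \<noteq> 0 \<longrightarrow>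
      card (Poly_Mapping.keys f) \<le> card (Poly_Mapping.keys g))" for f
    \<comment> \<open>The minimal element is quantified inside the relation because applying an
      arrow replaces it by another one.\<close>
    define R where "R x y \<longleftrightarrow> (\<exists>f. minimal f \<and> x \<in> Poly_Mapping.keys f \<and> y \<in> Poly_Mapping.keys f)" for x y
    obtain f where f: "minimal f"
      using False U(2) ex_has_least_nat[of "\<lambda>f. f \<in> U \<and> f \<noteq> 0" _ "\<lambda>f. card (Poly_Mapping.keys f)"]
      unfolding minimal_def by blast
    have "bs_bisim Q X R"
      unfolding bs_bisim_def
    proof (intro allI impI conjI ballI)
      fix x y assume "R x y"
      then obtain f where f: "minimal f" "x \<in> Poly_Mapping.keys f" "y \<in> Poly_Mapping.keys f"
        by (auto simp: R_def)
      then have fU: "f \<in> U" by (simp add: minimal_def)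
      show "x \<in> points X" "y \<in> points X" using f U(1)[OF fU] by auto
      show "y \<in> vset X i" if i: "i \<in> verts Q" "x \<in> vset X i" for i
      proof -
        \<comment> \<open>Restriction to the vertex set keeps \<open>x\<close> in the support, so
          the result is nonzero and minimality forbids losing any other point.\<close>
        define g where "g = lin_ext (basis_act Q X (Vert i)) f"
        have keys: "Poly_Mapping.keys g = Poly_Mapping.keys f \<inter> vset X i"
          by (auto simp: g_def in_keys_iff lookup_act_Vert split: if_splits)
        have "g \<in> U" unfolding g_def using act fU i by (auto simp: lgens_def)
        moreover have "g \<noteq> 0" using keys i f by auto
        ultimately have "card (Poly_Mapping.keys f) \<le> card (Poly_Mapping.keys f \<inter> vset X i)"
          using f(1) keys by (auto simp: minimal_def)
        then have "Poly_Mapping.keys f \<inter> vset X i = Poly_Mapping.keys f"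
          by (intro card_seteq) auto
        with f show ?thesis by auto
      qed
      fix \<alpha> x' assume \<alpha>: "\<alpha> \<in> arcs Q" and x': "x' \<in> vset X (head Q \<alpha>)" "x = sig X \<alpha> x'"
      \<comment> \<open>The support of \<open>g\<close> embeds into that of \<open>f\<close> by
        \<sigma>. As \<open>g\<close> is nonzero, minimality of \<open>f\<close> makes the embedding
        onto; hence \<open>g\<close> is minimal too, and \<open>y\<close> has a preimage in its
        support.\<close>
      define g where "g = lin_ext (basis_act Q X (Arr \<alpha>)) f"
      have keys: "Poly_Mapping.keys g = {z \<in> vset X (head Q \<alpha>). sig X \<alpha> z \<in> Poly_Mapping.keys f}"
        by (auto simp: g_def in_keys_iff lookup_act_Arr[OF \<alpha>] split: if_splits)
      have gU: "g \<in> U" unfolding g_def using act fU \<alpha> by (auto simp: lgens_def)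
      have g0: "g \<noteq> 0" and x'g: "x' \<in> Poly_Mapping.keys g" using keys x' f(2) by auto
      have img: "sig X \<alpha> ` Poly_Mapping.keys g \<subseteq> Poly_Mapping.keys f" by (auto simp: keys)
      have "inj_on (sig X \<alpha>) (Poly_Mapping.keys g)"
        using sig_inj[OF \<alpha>] by (auto simp: keys inj_on_def)
      then have card: "card (sig X \<alpha> ` Poly_Mapping.keys g) = card (Poly_Mapping.keys g)"
        by (rule card_image)
      have le: "card (Poly_Mapping.keys f) \<le> card (Poly_Mapping.keys g)"
        using f(1) gU g0 by (auto simp: minimal_def)
      then have eq: "sig X \<alpha> ` Poly_Mapping.keys g = Poly_Mapping.keys f"
        using img card by (intro card_seteq) auto
      then have "minimal g" using f(1) gU g0 card by (simp add: minimal_def)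
      moreover obtain y' where "y' \<in> Poly_Mapping.keys g" "y = sig X \<alpha> y'"
        using eq f(3) by blast
      moreover from this have "y' \<in> vset X (head Q \<alpha>)" by (simp add: keys)
      ultimately show "\<exists>y'\<in>vset X (head Q \<alpha>). y = sig X \<alpha> y' \<and> R x' y'"
        using x'g unfolding R_def by blast
    qed
    then have R: "x = y" if "R x y" for x y using sep that by (auto simp: bs_separated_def)
    have "Poly_Mapping.keys f \<noteq> {}" using f by (simp add: minimal_def)
    then obtain x where x: "x \<in> Poly_Mapping.keys f" by blast
    have "Poly_Mapping.keys f = {x}" using R f x unfolding R_def by blast
    moreover have "Poly_Mapping.lookup f x \<noteq> 0" using x by (simp add: in_keys_iff)
    ultimately have "Poly_Mapping.single x 1 = pscale (inverse (Poly_Mapping.lookup f x)) f"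
      by (intro poly_mapping_eqI) (auto simp: lookup_single when_def in_keys_iff)
    then have xU: "Poly_Mapping.single x 1 \<in> U" using U(4) f by (simp add: minimal_def)
    \<comment> \<open>Ghost arrows move a basis vector forward along \<sigma> and arrows move it
      back, so \<open>C\<close> is closed in both directions.\<close>
    define C where "C = {x \<in> points X. Poly_Mapping.single x 1 \<in> U}"
    have "orbit_closed Q X C"
      unfolding orbit_closed_def
    proof (intro conjI ballI)
      fix \<alpha> y assume \<alpha>: "\<alpha> \<in> arcs Q" and y: "y \<in> vset X (head Q \<alpha>)"
      then have gens: "Arr \<alpha> \<in> lgens Q" "Ghost \<alpha> \<in> lgens Q" and p: "sig X \<alpha> y \<in> points X" "y \<in> points X"
        using sig_points vset_points[of "head Q \<alpha>"] by (auto simp: lgens_def)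
      show "sig X \<alpha> y \<in> C \<longleftrightarrow> y \<in> C"
        using act[OF gens(1), of "Poly_Mapping.single (sig X \<alpha> y) 1"]
          act[OF gens(2), of "Poly_Mapping.single y 1"] sig_mem[OF \<alpha> y] sig_inv[OF \<alpha> y] y p
        by (auto simp: C_def)
    qed (auto simp: C_def)
    moreover have "x \<in> C" using xU x f U(1) by (auto simp: C_def minimal_def)
    ultimately have "C = points X" using con by (auto simp: bs_connected_def)
    then have single: "Poly_Mapping.single y c \<in> U" if "y \<in> points X" for y c
      using that U(4)[of "Poly_Mapping.single y 1" c] by (auto simp: C_def)
    have "g \<in> U" if "Poly_Mapping.keys g \<subseteq> points X" for g
      by (rule single_add_induct[of "\<lambda>g. g \<in> U"]) (use that single U in auto)
    then show ?thesis using U(1) by (auto simp: assoc_space_def)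
  qed (simp add: assoc_space_def)
qed

end


section \<open>Perfect branching systems\<close>

locale perfect_branching_system = branching_system Q X
  for Q :: "('v, 'e) pre_digraph" and X :: "('v, 'e, 'x) branching" +
  assumes perfect: "perfect_bs Q X"
begin

lemma point_vset:
  assumes "x \<in> points X"
  obtains i where "i \<in> verts Q" "x \<in> vset X i"
  using assms perfect unfolding perfect_bs_def saturated_bs_def by blast

lemma vset_aset:
  assumes "x \<in> vset X i" "i \<in> verts Q" "\<not> sink Q i"
  obtains \<alpha> where "\<alpha> \<in> arcs Q" "tail Q \<alpha> = i" "x \<in> aset X \<alpha>"
proof -
  have "x \<in> (\<Union>\<alpha>\<in>out_arcs Q i. aset X \<alpha>)" using assms perfect unfolding perfect_bs_def by blast
  then show thesis using that by auto
qed

text \<open>Saturation places the point over a vertex. If this is not a sink, perfectness supplies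
  an arrow, even at an infinite emitter.\<close>

lemma point_cases:
  assumes "x \<in> points X"
  obtains (sink) i where "sink Q i" "x \<in> vset X i"
  | (arrow) \<alpha> y where "\<alpha> \<in> arcs Q" "y \<in> vset X (head Q \<alpha>)" "x = sig X \<alpha> y"
proof -
  obtain i where i: "i \<in> verts Q" "x \<in> vset X i" using point_vset[OF assms] .
  show thesis
  proof (cases "sink Q i")
    case False
    then obtain \<alpha> where \<alpha>: "\<alpha> \<in> arcs Q" "x \<in> aset X \<alpha>" using vset_aset[OF i(2,1)] by metis
    then show thesis using aset_E[OF \<alpha>] arrow by metis
  qed (use i sink in blast)
qed

text \<open>The image of a morphism out of a perfect system is orbit-closed. Closure under inverses
  is the point at issue: a preimage must itself be decomposed by an arrow of
  \<open>Y\<close>.\<close>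

lemma connected_imp_surj:
  assumes con: "bs_connected Q X" and "points Y \<noteq> {}"
    and Y: "perfect_branching_system Q Y" and f: "bs_morphism Q Y X f"
  shows "f ` points Y = points X"
proof -
  interpret Y: perfect_branching_system Q Y by fact
  have "orbit_closed Q X (f ` points Y)"
    unfolding orbit_closed_def
  proof (intro conjI ballI iffI)
    show "f ` points Y \<subseteq> points X" using bs_morphismD(1)[OF f] by blast
    fix \<alpha> x assume \<alpha>: "\<alpha> \<in> arcs Q" and x: "x \<in> vset X (head Q \<alpha>)"
    {
      assume "sig X \<alpha> x \<in> f ` points Y"
      then obtain y where y: "y \<in> points Y" "sig X \<alpha> x = f y" by blast
      from y(1) show "x \<in> f ` points Y"
      proof (cases rule: Y.point_cases)
        \<comment> \<open>Impossible: \<open>f y\<close> equals \<open>sig X \<alpha> x\<close> and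
          so lies over the tail of \<alpha>, from which \<alpha> starts.\<close>
        case (sink i)
        then have "f y \<in> vset X i" using bs_morphismD(2)[OF f] by (auto simp: sink_def)
        moreover have "f y \<in> vset X (tail Q \<alpha>)" using sig_mem[OF \<alpha> x] aset_vset[OF \<alpha>] y by auto
        ultimately have "i = tail Q \<alpha>" using vset_unique sink \<alpha> by (auto simp: sink_def)
        then show ?thesis using sink \<alpha> by (auto simp: sink_def)
      next
        case (arrow \<beta> z)
        then have "sig X \<alpha> x = sig X \<beta> (f z)" "f z \<in> vset X (head Q \<beta>)"
          using bs_morphismD(2,4)[OF f] y by auto
        then have "x = f z" using sig_eq(2)[OF \<alpha> x arrow(1)] by blast
        then show ?thesis using arrow Y.vset_points[of "head Q \<beta>"] by auto
      qed
    next
      assume "x \<in> f ` points Y"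
      then obtain y where y: "y \<in> points Y" "x = f y" by blast
      obtain i where i: "i \<in> verts Q" "y \<in> vset Y i" using Y.point_vset y by metis
      then have "i = head Q \<alpha>"
        using bs_morphismD(2)[OF f, of i y] x y vset_unique[of x i "head Q \<alpha>"] \<alpha> by auto
      then show "sig X \<alpha> x \<in> f ` points Y"
        using y i bs_morphismD(4)[OF f \<alpha>, of y] Y.sig_points[OF \<alpha>, of y]
        by (intro image_eqI[of _ _ "sig Y \<alpha> y"]) auto
    }
  qed
  moreover have "f ` points Y \<noteq> {}" using assms(2) by simp
  ultimately show ?thesis using con by (simp add: bs_connected_def)
qed

end

section \<open>Morphisms between perfect systems\<close>

lemma bs_isomorphic_sym: "bs_isomorphic Q X Y \<Longrightarrow> bs_isomorphic Q Y X"
  unfolding bs_isomorphic_def by blast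

locale perfect_morphism = X: perfect_branching_system Q X + Y: perfect_branching_system Q Y
  for Q :: "('v, 'e) pre_digraph"
    and X :: "('v, 'e, 'x) branching" and Y :: "('v, 'e, 'y) branching" +
  fixes f :: "'x \<Rightarrow> 'y"
  assumes morphism: "bs_morphism Q X Y f"
begin

lemmas mor = bs_morphismD[OF morphism]

text \<open>By saturation the point lies over some vertex; the morphism preserves it, and
  disjointness in \<open>Y\<close> identifies it.\<close>

lemma vset_reflect:
  assumes "x \<in> points X" "i \<in> verts Q" "f x \<in> vset Y i"
  shows "x \<in> vset X i"
proof -
  obtain j where j: "j \<in> verts Q" "x \<in> vset X j" using X.point_vset[OF assms(1)] .
  then show ?thesis using Y.vset_unique[OF mor(2)[OF j] assms(3) j(1) assms(2)] by simp
qed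

text \<open>Perfectness of \<open>X\<close> gives the point some first arrow; its image has the same
  first arrow, which is unique in \<open>Y\<close>.\<close>

lemma aset_reflect:
  assumes "x \<in> points X" "\<alpha> \<in> arcs Q" "f x \<in> aset Y \<alpha>"
  shows "x \<in> aset X \<alpha>"
proof -
  have "x \<in> vset X (tail Q \<alpha>)" by (rule vset_reflect) (use Y.aset_vset assms in auto)
  moreover have "\<not> sink Q (tail Q \<alpha>)" using assms by (auto simp: sink_def)
  ultimately obtain \<beta> where \<beta>: "\<beta> \<in> arcs Q" "x \<in> aset X \<beta>"
    using X.vset_aset X.tail_in_verts[OF assms(2)] by metis
  then have "\<beta> = \<alpha>" using Y.aset_unique[OF mor(3)[OF \<beta>] assms(3)] assms(2) by blast
  with \<beta> show ?thesis by simp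
qed

text \<open>A first step of the itinerary of \<open>f x\<close> lifts to \<open>x\<close>. This
  lifting drives all transfers along \<open>f\<close> below.\<close>

lemma sig_reflect:
  assumes "x \<in> points X" "\<alpha> \<in> arcs Q" "z \<in> vset Y (head Q \<alpha>)" "f x = sig Y \<alpha> z"
  obtains y where "y \<in> vset X (head Q \<alpha>)" "x = sig X \<alpha> y" "z = f y"
proof -
  have "x \<in> aset X \<alpha>" using aset_reflect Y.sig_mem assms by metis
  then obtain y where y: "y \<in> vset X (head Q \<alpha>)" "x = sig X \<alpha> y"
    using X.aset_E[OF assms(2)] by metis
  then have "f y \<in> vset Y (head Q \<alpha>)" "sig Y \<alpha> (f y) = sig Y \<alpha> z"
    using mor(2,4) assms(2,4) by auto
  then have "z = f y" using Y.sig_inj[OF assms(2) _ assms(3)] by auto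
  with y show thesis by (rule that)
qed

text \<open>A set-theoretic inverse is automatically a morphism, because vertices, arrows and steps
  are all reflected.\<close>

lemma isomorphicI:
  assumes "inj_on f (points X)" "f ` points X = points Y"
  shows "bs_isomorphic Q X Y"
proof -
  define g where "g = inv_into (points X) f"
  have gf: "g (f x) = x" if "x \<in> points X" for x using that assms by (simp add: g_def)
  have g: "g y \<in> points X" "f (g y) = y" if "y \<in> points Y" for y
    using that assms by (auto simp: g_def inv_into_into f_inv_into_f)
  have "bs_morphism Q Y X g"
    unfolding bs_morphism_def
  proof (intro conjI ballI image_subsetI)
    show "g y \<in> vset X i" if "i \<in> verts Q" "y \<in> vset Y i" for i y
      using that g[of y] Y.vset_points[of i] by (auto intro!: vset_reflect)
    show "g y \<in> aset X \<alpha>" if "\<alpha> \<in> arcs Q" "y \<in> aset Y \<alpha>" for \<alpha> y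
      using that g[of y] Y.aset_points[of \<alpha>] by (auto intro!: aset_reflect)
    fix \<alpha> y assume \<alpha>: "\<alpha> \<in> arcs Q" and y: "y \<in> vset Y (head Q \<alpha>)"
    have p: "sig Y \<alpha> y \<in> points Y" using Y.sig_points \<alpha> y .
    obtain x where x: "x \<in> vset X (head Q \<alpha>)" "g (sig Y \<alpha> y) = sig X \<alpha> x" "y = f x"
      using sig_reflect[OF g(1)[OF p] \<alpha> y g(2)[OF p]] .
    then show "g (sig Y \<alpha> y) = sig X \<alpha> (g y)" using gf X.vset_points[of "head Q \<alpha>"] \<alpha> by auto
  qed (use g in auto)
  then show ?thesis unfolding bs_isomorphic_def using morphism gf g by blast
qed

text \<open>Having the same image under \<open>f\<close> is a bisimulation, since the steps of a
  common image lift to both points.\<close>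

lemma separated_imp_inj:
  assumes "bs_separated Q X"
  shows "inj_on f (points X)"
proof -
  have "bs_bisim Q X (\<lambda>x y. x \<in> points X \<and> y \<in> points X \<and> f x = f y)"
    unfolding bs_bisim_def
  proof (intro allI impI conjI ballI; elim conjE)
    show "y \<in> vset X i" if "i \<in> verts Q" "x \<in> vset X i" "y \<in> points X" "f x = f y" for x y i
      using that mor(2)[of i x] vset_reflect[of y i] by auto
    fix x y \<alpha> x' assume *: "y \<in> points X" "f x = f y" "\<alpha> \<in> arcs Q" "x' \<in> vset X (head Q \<alpha>)" "x = sig X \<alpha> x'"
    then have "f x' \<in> vset Y (head Q \<alpha>)" "f y = sig Y \<alpha> (f x')" using mor(2,4) by auto
    from sig_reflect[OF *(1,3) this]
    obtain y' where "y' \<in> vset X (head Q \<alpha>)" "y = sig X \<alpha> y'" "f x' = f y'" .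
    with * show "\<exists>y'\<in>vset X (head Q \<alpha>). y = sig X \<alpha> y' \<and> x' \<in> points X \<and> y' \<in> points X \<and> f x' = f y'"
      using X.vset_points[OF X.head_in_verts[OF *(3)]] by blast
  qed
  then show ?thesis using assms unfolding bs_separated_def inj_on_def by blast
qed

text \<open>The image of a bisimulation under \<open>f\<close> is a bisimulation on
  \<open>Y\<close>, hence contained in equality; injectivity brings this back to
  \<open>X\<close>.\<close>

lemma separated_reflect:
  assumes "bs_separated Q Y" "inj_on f (points X)"
  shows "bs_separated Q X"
  unfolding bs_separated_def
proof (intro allI impI)
  fix R x y assume R: "bs_bisim Q X R" and xy: "R x y"
  note D = bs_bisimD[OF R]
  have "bs_bisim Q Y (\<lambda>a b. \<exists>x y. a = f x \<and> b = f y \<and> R x y)"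
    unfolding bs_bisim_def
  proof (intro allI impI conjI ballI; elim exE conjE)
    show "b \<in> vset Y i" if "i \<in> verts Q" "a \<in> vset Y i" "a = f x" "b = f y" "R x y" for a b x y i
      using that D(1,3)[OF that(5)] vset_reflect[of x i] mor(2)[of i y] by auto
    fix a b \<alpha> z x y
    assume \<alpha>: "\<alpha> \<in> arcs Q" and *: "z \<in> vset Y (head Q \<alpha>)" "a = sig Y \<alpha> z" "a = f x" "b = f y" "R x y"
    obtain x' where x': "x' \<in> vset X (head Q \<alpha>)" "x = sig X \<alpha> x'" "z = f x'"
      using sig_reflect[OF D(1)[OF *(5)] \<alpha> *(1)] *(2,3) by metis
    obtain y' where y': "y' \<in> vset X (head Q \<alpha>)" "y = sig X \<alpha> y'" "R x' y'"
      using D(4)[OF *(5) \<alpha> x'(1,2)] by blast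
    then have "f y' \<in> vset Y (head Q \<alpha>)" "b = sig Y \<alpha> (f y')" using mor(2,4) \<alpha> * by auto
    with x' y' show "\<exists>c\<in>vset Y (head Q \<alpha>). b = sig Y \<alpha> c \<and> (\<exists>x y. z = f x \<and> c = f y \<and> R x y)"
      by blast
  qed (use D mor(1) in auto)
  then have "f x = f y" using assms(1) xy unfolding bs_separated_def by blast
  then show "x = y" using assms(2) D(1,2)[OF xy] by (auto dest: inj_onD)
qed

text \<open>The linear extension of \<open>f\<close> commutes with the generators, so its kernel is
  a subrepresentation. It is proper because basis vectors map to basis vectors, and it would contain
  a nonzero difference of two of them if \<open>f\<close> identified two points. Connectedness would
  not suffice: over a single loop, \<sigma> may swap two points, which then have the same
  itinerary.\<close>

lemma irreducible_imp_inj: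
  assumes irr: "irreducible_representation
    (leavitt_path_algebra Q :: ('k::field, ('v, 'e, 'k) falg set) kalg)
    (assoc_space X) (assoc_rep Q X)"
  shows "inj_on f (points X)"
proof (rule inj_onI, rule ccontr)
  fix x y assume xy: "x \<in> points X" "y \<in> points X" "f x = f y" "x \<noteq> y"
  define L :: "('x \<Rightarrow>\<^sub>0 'k) \<Rightarrow> ('y \<Rightarrow>\<^sub>0 'k)" where "L = lin_ext (\<lambda>x. Poly_Mapping.single (f x) 1)"
  define U where "U = {h. Poly_Mapping.keys h \<subseteq> points X \<and> L h = 0}"
  \<comment> \<open>Equivariance on basis vectors. Reflection ensures that a generator kills the
    image only if it kills the basis vector itself.\<close>
  have base: "L (basis_act Q X g x) = basis_act Q Y g (f x)" if "x \<in> points X" "g \<in> lgens Q" for g x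
  proof (cases g)
    case (Vert i)
    then have "i \<in> verts Q" using that by (auto simp: lgens_def)
    then have "f x \<in> vset Y i \<longleftrightarrow> x \<in> vset X i" using vset_reflect mor(2) that by blast
    then show ?thesis by (simp add: L_def Vert)
  next
    case (Ghost \<alpha>)
    then have \<alpha>: "\<alpha> \<in> arcs Q" using that by (auto simp: lgens_def)
    then have "f x \<in> vset Y (head Q \<alpha>) \<longleftrightarrow> x \<in> vset X (head Q \<alpha>)"
      using vset_reflect mor(2) that by auto
    then show ?thesis using mor(4)[OF \<alpha>] by (simp add: L_def Ghost)
  next
    case (Arr \<alpha>)
    then have \<alpha>: "\<alpha> \<in> arcs Q" using that by (auto simp: lgens_def)
    have iff: "f x \<in> aset Y \<alpha> \<longleftrightarrow> x \<in> aset X \<alpha>" using aset_reflect mor(3) that \<alpha> by blast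
    show ?thesis
    proof (cases "x \<in> aset X \<alpha>")
      case True
      then obtain z where z: "z \<in> vset X (head Q \<alpha>)" "x = sig X \<alpha> z" using X.aset_E[OF \<alpha>] by metis
      then have "f x = sig Y \<alpha> (f z)" "f z \<in> vset Y (head Q \<alpha>)" using mor(2,4) \<alpha> by auto
      with z True iff show ?thesis
        using X.sig_inv[OF \<alpha> z(1)] Y.sig_inv[OF \<alpha>, of "f z"] by (simp add: L_def Arr)
    qed (simp add: Arr L_def iff)
  qed
  have "U = {0} \<or> U = {h. Poly_Mapping.keys h \<subseteq> points X}"
  proof (rule X.irreducibleD[OF irr])
    show "h + h' \<in> U" if "h \<in> U" "h' \<in> U" for h h'
      using that keys_add[of h h'] by (auto simp: U_def L_def lin_ext_add)
    show "pscale c h \<in> U" if "h \<in> U" for c h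
      using that keys_pscale[of c h] by (auto simp: U_def L_def lin_ext_scale)
    show "lin_ext (basis_act Q X g) h \<in> U" if g: "g \<in> lgens Q" and "h \<in> U" for g h
    proof -
      have h: "Poly_Mapping.keys h \<subseteq> points X" "L h = 0" using that by (auto simp: U_def)
      have "L (lin_ext (basis_act Q X g) h) = lin_ext (\<lambda>x. L (basis_act Q X g x)) h"
        unfolding L_def by (rule lin_ext_lin_ext)
      also have "\<dots> = lin_ext (\<lambda>x. basis_act Q Y g (f x)) h"
        using h base g by (intro lin_ext_cong) auto
      also have "\<dots> = lin_ext (basis_act Q Y g) (L h)"
        unfolding L_def lin_ext_lin_ext by simp
      finally show ?thesis
        using h X.keys_basis_act[OF g] by (auto simp: U_def intro!: keys_lin_ext dest!: subsetD)
    qed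
  qed (auto simp: U_def L_def)
  moreover have "Poly_Mapping.single x 1 - Poly_Mapping.single y 1 \<in> U"
    using xy keys_diff[of "Poly_Mapping.single x (1::'k)" "Poly_Mapping.single y 1"]
    by (auto simp: U_def L_def lin_ext_diff split: if_splits)
  moreover have "Poly_Mapping.single x (1::'k) - Poly_Mapping.single y 1 \<noteq> 0"
    using xy by (auto simp: poly_mapping_eq_iff fun_eq_iff lookup_minus lookup_single when_def)
  moreover have "Poly_Mapping.single x 1 \<notin> U" by (simp add: U_def L_def single_one_nonzero)
  ultimately show False using xy by auto
qed

text \<open>Lifting of steps makes the image of an orbit-closed set orbit-closed, hence all of
  \<open>Y\<close>; injectivity then recovers all of \<open>X\<close>.\<close>

lemma connected_reflect:
  assumes "bs_connected Q Y" "inj_on f (points X)"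
  shows "bs_connected Q X"
  unfolding bs_connected_def
proof (intro allI impI)
  fix C assume C: "orbit_closed Q X C" "C \<noteq> {}"
  then have sub: "C \<subseteq> points X" by (simp add: orbit_closed_def)
  have "orbit_closed Q Y (f ` C)"
    unfolding orbit_closed_def
  proof (intro conjI ballI iffI)
    show "f ` C \<subseteq> points Y" using sub mor(1) by blast
    fix \<alpha> z assume \<alpha>: "\<alpha> \<in> arcs Q" and z: "z \<in> vset Y (head Q \<alpha>)"
    {
      assume "sig Y \<alpha> z \<in> f ` C"
      then obtain x where x: "x \<in> C" "f x = sig Y \<alpha> z" by (metis imageE)
      obtain y where "y \<in> vset X (head Q \<alpha>)" "x = sig X \<alpha> y" "z = f y"
        using sig_reflect[OF subsetD[OF sub x(1)] \<alpha> z x(2)] .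
      then show "z \<in> f ` C" using C(1) \<alpha> x by (auto simp: orbit_closed_def)
    next
      assume "z \<in> f ` C"
      then obtain x where x: "x \<in> C" "z = f x" by blast
      then have "x \<in> vset X (head Q \<alpha>)" using vset_reflect sub z \<alpha> by auto
      then have "sig X \<alpha> x \<in> C" "f (sig X \<alpha> x) = sig Y \<alpha> z"
        using C(1) \<alpha> x mor(4) by (auto simp: orbit_closed_def)
      then show "sig Y \<alpha> z \<in> f ` C" by (metis imageI)
    }
  qed
  then have "f ` C = points Y" using assms(1) C(2) by (auto simp: bs_connected_def)
  then show "C = points X" using sub assms(2) mor(1) by (auto simp: inj_on_def) blast
qed

end

text \<open>The combinatorial properties are carried along the isomorphism, so the two
  representations never have to be compared.\<close>

lemma isomorphic_imp_irreducible:
  fixes X :: "('v, 'e, 'x) branching" and Y :: "('v, 'e, 'y) branching"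
  assumes "perfect_branching_system Q X" "perfect_branching_system Q Y" "bs_isomorphic Q X Y"
    and Y: "bs_connected Q Y" "bs_separated Q Y" "points Y \<noteq> {}"
  shows "irreducible_representation
    (leavitt_path_algebra Q :: ('k::field, ('v, 'e, 'k) falg set) kalg)
    (assoc_space X) (assoc_rep Q X)"
proof -
  obtain f g where fg: "bs_morphism Q X Y f" "bs_morphism Q Y X g" "\<forall>x\<in>points X. g (f x) = x"
    using assms(3) unfolding bs_isomorphic_def by blast
  interpret perfect_morphism Q X Y f
    using assms fg by (simp add: perfect_morphism_def perfect_morphism_axioms_def)
  have inj: "inj_on f (points X)" using fg(3) by (intro inj_on_inverseI) auto
  have "points X \<noteq> {}" using Y(3) bs_morphismD(1)[OF fg(2)] by blast
  with X.connected_separated_imp_irreducible connected_reflect separated_reflect Y inj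
  show ?thesis by blast
qed


section \<open>Tail-equivalence classes and paths to a sink\<close>

context wf_digraph
begin

lemma perfect_branching_system_tail_bs: "perfect_branching_system G (tail_bs G p)"
  by (simp add: perfect_branching_system_def perfect_branching_system_axioms_def
      branching_system_tail_bs perfect_bs_tail_bs)

lemma perfect_branching_system_sink_bs: "sink G i \<Longrightarrow> perfect_branching_system G (sink_bs G i)"
  by (simp add: perfect_branching_system_def perfect_branching_system_axioms_def
      branching_system_sink_bs perfect_bs_sink_bs)

lemma tail_bs_points:
  "q \<in> points (tail_bs G p) \<longleftrightarrow> left_infinite_path G q \<and> tail_equivalent p q"
  by (simp add: tail_bs_def Let_def)

lemma tail_bs_step:
  assumes "q \<in> points (tail_bs G p)"
  shows "shd q \<in> arcs G" "stl q \<in> vset (tail_bs G p) (head G (shd q))"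
    "stl q \<in> points (tail_bs G p)" "q = sig (tail_bs G p) (shd q) (stl q)"
proof -
  obtain \<alpha> q' where "q = \<alpha> ## q'" by (cases q)
  with assms show "shd q \<in> arcs G" "stl q \<in> vset (tail_bs G p) (head G (shd q))"
    "stl q \<in> points (tail_bs G p)" "q = sig (tail_bs G p) (shd q) (stl q)"
    by (auto simp: tail_bs_def Let_def left_infinite_path_SCons tail_equivalent_SCons)
qed

text \<open>Dropping the first arrow inverts one \<sigma>, so membership does not change at any
  stage.\<close>

lemma orbit_closed_sdrop:
  assumes "orbit_closed G (tail_bs G p) C" "q \<in> points (tail_bs G p)"
  shows "sdrop n q \<in> C \<longleftrightarrow> q \<in> C"
  using assms(2)
proof (induction n arbitrary: q)
  case (Suc n)
  note st = tail_bs_step[OF Suc.prems]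
  have "stl q \<in> C \<longleftrightarrow> q \<in> C"
    using assms(1) st(1,2,4) unfolding orbit_closed_def by metis
  then show ?case using Suc.IH[OF st(3)] by simp
qed simp

lemma tail_bs_connected: "bs_connected G (tail_bs G p)"
  unfolding bs_connected_def
proof (intro allI impI)
  fix C assume C: "orbit_closed G (tail_bs G p) C" "C \<noteq> {}"
  then have sub: "C \<subseteq> points (tail_bs G p)" by (simp add: orbit_closed_def)
  obtain q where q: "q \<in> C" using C by blast
  have "q' \<in> C" if q': "q' \<in> points (tail_bs G p)" for q'
  proof -
    have qp: "q \<in> points (tail_bs G p)" using q sub by blast
    then obtain a b where ab: "sdrop a p = sdrop b q"
      by (auto simp: tail_bs_points tail_equivalent_def)
    obtain c d where cd: "sdrop c p = sdrop d q'"
      using q' by (auto simp: tail_bs_points tail_equivalent_def)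
    \<comment> \<open>The two comparisons cut \<open>p\<close> after \<open>a\<close> and after
      \<open>c\<close> arrows; cutting further, both reach the tail of \<open>p\<close> after
      \<open>a + c\<close> arrows.\<close>
    have "sdrop (b + c) q = sdrop c (sdrop a p)" by (simp add: ab sdrop_add)
    also have "\<dots> = sdrop a (sdrop c p)" by (simp add: sdrop_add add.commute)
    also have "\<dots> = sdrop (d + a) q'" by (simp add: cd sdrop_add)
    finally show ?thesis
      using orbit_closed_sdrop[OF C(1) qp, of "b + c"] orbit_closed_sdrop[OF C(1) q', of "d + a"] q
      by simp
  qed
  with sub show "C = points (tail_bs G p)" by blast
qed

text \<open>A bisimulation here is a bisimulation of streams: related paths have equal heads and
  related tails, so coinduction applies.\<close>

lemma tail_bs_separated: "bs_separated G (tail_bs G p)"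
  unfolding bs_separated_def
proof (intro allI impI)
  fix R q q' assume R: "bs_bisim G (tail_bs G p) R" and "R q q'"
  have step: "shd x = shd y \<and> R (stl x) (stl y)" if xy: "R x y" for x y
  proof -
    have x: "x \<in> points (tail_bs G p)" using bs_bisimD(1)[OF R xy] .
    note st = tail_bs_step[OF x]
    show ?thesis using bs_bisimD(4)[OF R xy st(1,2,4)] by (auto simp: tail_bs_def Let_def)
  qed
  show "q = q'" using \<open>R q q'\<close> by (coinduction arbitrary: q q') (use step in auto)
qed

lemma sink_bs_points: "(u, w) \<in> points (sink_bs G i) \<longleftrightarrow> awalk u w i"
  and sink_bs_vset_iff: "(u, w) \<in> vset (sink_bs G i) j \<longleftrightarrow> awalk u w i \<and> u = j"
  and sink_bs_sig: "sig (sink_bs G i) \<alpha> (u, w) = (tail G \<alpha>, \<alpha> # w)"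
  by (simp_all add: sink_bs_def Let_def)

lemma awalk_sink_iff: "sink G i \<Longrightarrow> awalk i w i \<longleftrightarrow> w = []"
  by (cases w) (auto simp: sink_def awalk_Cons_conv awalk_Nil_iff)

text \<open>Removing first arrows one by one reduces every path to the trivial path at
  \<open>i\<close>, so all paths share one membership status.\<close>

lemma sink_bs_connected: "bs_connected G (sink_bs G i)"
  unfolding bs_connected_def
proof (intro allI impI)
  fix C assume C: "orbit_closed G (sink_bs G i) C" "C \<noteq> {}"
  then have sub: "C \<subseteq> points (sink_bs G i)" by (simp add: orbit_closed_def)
  have iff: "(u, w) \<in> C \<longleftrightarrow> (i, []) \<in> C" if "awalk u w i" for u w
    using that
  proof (induction w arbitrary: u)
    case (Cons \<alpha> w)
    then have a: "\<alpha> \<in> arcs G" "u = tail G \<alpha>" "awalk (head G \<alpha>) w i"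
      by (auto simp: awalk_Cons_conv)
    then have "(head G \<alpha>, w) \<in> vset (sink_bs G i) (head G \<alpha>)" by (simp add: sink_bs_vset_iff)
    then have "(u, \<alpha> # w) \<in> C \<longleftrightarrow> (head G \<alpha>, w) \<in> C"
      using C(1) a(1) unfolding orbit_closed_def by (metis sink_bs_sig a(2))
    with Cons.IH[OF a(3)] show ?case by simp
  qed (auto simp: awalk_Nil_iff)
  obtain v w where "(v, w) \<in> C" using C(2) by (metis ex_in_conv surj_pair)
  then have "(i, []) \<in> C" using iff sub sink_bs_points by blast
  then have "points (sink_bs G i) \<subseteq> C" using iff sink_bs_points by auto
  with sub show "C = points (sink_bs G i)" by blast
qed

lemma sink_bs_separated:
  assumes i: "sink G i"
  shows "bs_separated G (sink_bs G i)"
  unfolding bs_separated_def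
proof (intro allI impI)
  fix R x y assume R: "bs_bisim G (sink_bs G i) R" and "R x y"
  have "(u, w) = (v, w')" if "R (u, w) (v, w')" for u v w w'
    using that
  proof (induction w arbitrary: u v w')
    case Nil
    note D = bs_bisimD[OF R Nil]
    \<comment> \<open>The first path is trivial, so the second also starts at \<open>i\<close>; as
      no arrow leaves a sink, it is trivial too.\<close>
    have "u = i" "i \<in> verts G" using D(1) by (auto simp: sink_bs_points awalk_Nil_iff)
    then have "v = i" "awalk v w' i" using D(1) D(3)[of i] by (auto simp: sink_bs_vset_iff sink_bs_points)
    then show ?case using \<open>u = i\<close> awalk_sink_iff[OF i] by simp
  next
    case (Cons \<alpha> w)
    note D = bs_bisimD[OF R Cons.prems]
    have a: "\<alpha> \<in> arcs G" "u = tail G \<alpha>" "awalk (head G \<alpha>) w i"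
      using D(1) by (auto simp: sink_bs_points awalk_Cons_conv)
    then obtain y where "y \<in> vset (sink_bs G i) (head G \<alpha>)" "(v, w') = sig (sink_bs G i) \<alpha> y"
      "R (head G \<alpha>, w) y"
      using D(4)[of \<alpha> "(head G \<alpha>, w)"] by (auto simp: sink_bs_vset_iff sink_bs_sig)
    then show ?case
      using Cons.IH a by (cases y) (auto simp: sink_bs_sig)
  qed
  then show "x = y" using \<open>R x y\<close> by (cases x, cases y) blast
qed

end

section \<open>Comparing a connected system with paths\<close>

context perfect_branching_system
begin

text \<open>Applying the bijections along a path to \<open>z\<close> gives a morphism from the paths
  ending at \<open>i\<close> to \<open>X\<close>. Connectedness of \<open>X\<close> makes it onto,
  and separation of its source makes it injective.\<close>

lemma connected_sink_imp_isomorphic: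
  assumes con: "bs_connected Q X" and i: "sink Q i" and z: "z \<in> vset X i"
  shows "bs_isomorphic Q X (sink_bs Q i)"
proof -
  \<comment> \<open>Lists begin with the first arrow, so \<open>foldr\<close> applies the bijection
    of the last arrow first, the one whose head is \<open>i\<close>.\<close>
  let ?g = "\<lambda>q. foldr (sig X) (snd q) z"
  have v: "foldr (sig X) w z \<in> vset X u" if "awalk u w i" for u w
    using that
  proof (induction w arbitrary: u)
    case (Cons \<alpha> w)
    then have "\<alpha> \<in> arcs Q" "u = tail Q \<alpha>" "foldr (sig X) w z \<in> vset X (head Q \<alpha>)"
      by (auto simp: awalk_Cons_conv)
    then show ?case using sig_mem aset_vset by auto
  qed (use z in \<open>auto simp: awalk_Nil_iff\<close>)
  have "bs_morphism Q (sink_bs Q i) X ?g"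
    unfolding bs_morphism_def
  proof (intro conjI ballI image_subsetI)
    show "?g q \<in> points X" if "q \<in> points (sink_bs Q i)" for q
      using that v[of "fst q" "snd q"] vset_points[of "fst q"]
      by (cases q) (auto simp: sink_bs_points)
    show "?g q \<in> vset X j" if "q \<in> vset (sink_bs Q i) j" for j q
      using that v by (cases q) (auto simp: sink_bs_vset_iff)
    fix \<alpha> q assume \<alpha>: "\<alpha> \<in> arcs Q" "q \<in> aset (sink_bs Q i) \<alpha>"
    then obtain u w where "q = (u, \<alpha> # w)" "awalk (head Q \<alpha>) w i"
      by (cases q; cases "snd q") (auto simp: sink_bs_def awalk_Cons_conv)
    then show "?g q \<in> aset X \<alpha>" using sig_mem[OF \<alpha>(1) v] by simp
  qed (auto simp: sink_bs_def Let_def)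
  then interpret g: perfect_morphism Q "sink_bs Q i" X ?g
    using perfect_branching_system_sink_bs[OF i] perfect_branching_system_axioms
    by (simp add: perfect_morphism_def perfect_morphism_axioms_def)
  have "(i, []) \<in> points (sink_bs Q i)"
    using i by (simp add: sink_bs_points awalk_Nil_iff sink_def)
  then have "?g ` points (sink_bs Q i) = points X"
    using connected_imp_surj[OF con _ perfect_branching_system_sink_bs[OF i] g.morphism] by blast
  then show ?thesis
    using g.isomorphicI g.separated_imp_inj sink_bs_separated[OF i] bs_isomorphic_sym by blast
qed

text \<open>Away from sinks every point has a first arrow, and peeling arrows forever yields an
  infinite path. Connectedness puts all these paths into one tail class.\<close>

lemma connected_imp_itinerary:
  assumes con: "bs_connected Q X" and ne: "points X \<noteq> {}"
    and no_sink: "\<And>i. sink Q i \<Longrightarrow> vset X i = {}"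
  obtains p f where "left_infinite_path Q p" "bs_morphism Q X (tail_bs Q p) f"
proof -
  have "\<exists>\<alpha> y. \<alpha> \<in> arcs Q \<and> y \<in> vset X (head Q \<alpha>) \<and> x = sig X \<alpha> y" if "x \<in> points X" for x
    using that by (cases rule: point_cases) (use no_sink in blast)+
  then obtain arr nxt where step: "\<And>x. x \<in> points X \<Longrightarrow>
      arr x \<in> arcs Q \<and> nxt x \<in> vset X (head Q (arr x)) \<and> x = sig X (arr x) (nxt x)"
    by metis
  define f where "f x = smap arr (siterate nxt x)" for x
  have f: "f x = arr x ## f (nxt x)" for x
    by (simp add: f_def siterate.code[of nxt x])
  \<comment> \<open>The functions \<open>arr\<close> and \<open>nxt\<close> come from choice, but
    uniqueness of the decomposition forces their values.\<close>
  have f_sig: "f (sig X \<alpha> y) = \<alpha> ## f y" if "\<alpha> \<in> arcs Q" "y \<in> vset X (head Q \<alpha>)" for \<alpha> y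
  proof -
    note s = step[OF sig_points[OF that]]
    have "\<alpha> = arr (sig X \<alpha> y)" "y = nxt (sig X \<alpha> y)"
      using sig_eq[OF that, of "arr (sig X \<alpha> y)" "nxt (sig X \<alpha> y)"] s by blast+
    then show ?thesis using f[of "sig X \<alpha> y"] by simp
  qed
  have nxt: "nxt x \<in> points X" if "x \<in> points X" for x
    using step[OF that] vset_points[of "head Q (arr x)"] by auto
  have arr_vset: "x \<in> vset X (tail Q (arr x))" "x \<in> aset X (arr x)" if "x \<in> points X" for x
    using step[OF that] sig_mem[of "arr x" "nxt x"] aset_vset[of "arr x"] by auto
  have path: "left_infinite_path Q (f x)" if "x \<in> points X" for x
    unfolding left_infinite_path_def
  proof
    fix n
    have p: "(nxt ^^ n) x \<in> points X" using that by (induction n) (auto intro: nxt)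
    let ?y = "(nxt ^^ n) x"
    have "head Q (arr ?y) = tail Q (arr (nxt ?y))"
      using step[OF p] step[OF nxt[OF p]] arr_vset(1)[OF nxt[OF p]] vset_unique
        head_in_verts tail_in_verts by metis
    then show "f x !! n \<in> arcs Q \<and> head Q (f x !! n) = tail Q (f x !! Suc n)"
      using step[OF p] by (simp add: f_def del: snth.simps(2))
  qed
  obtain x0 where x0: "x0 \<in> points X" using ne by blast
  \<comment> \<open>Prepending an arrow does not change the tail class, so this set is orbit-closed;
    the base point \<open>x0\<close> is arbitrary.\<close>
  let ?C = "{x \<in> points X. tail_equivalent (f x0) (f x)}"
  have "orbit_closed Q X ?C"
    using sig_points vset_points[OF head_in_verts]
    by (auto simp: orbit_closed_def f_sig tail_equivalent_SCons)
  moreover have "x0 \<in> ?C" using x0 by (auto simp: tail_equivalent_def)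
  ultimately have C: "?C = points X" using con unfolding bs_connected_def by blast
  have mem: "f x \<in> points (tail_bs Q (f x0))" if "x \<in> points X" for x
    using that C path[OF that] by (auto simp: tail_bs_points)
  have "bs_morphism Q X (tail_bs Q (f x0)) f"
    unfolding bs_morphism_def
  proof (intro conjI ballI image_subsetI)
    show "f x \<in> vset (tail_bs Q (f x0)) i" if i: "i \<in> verts Q" "x \<in> vset X i" for i x
    proof -
      have x: "x \<in> points X" using i vset_points by blast
      then have "i = tail Q (arr x)"
        using vset_unique[OF i(2) arr_vset(1)[OF x] i(1)] step[OF x] by simp
      then show ?thesis using mem[OF x] f[of x] by (simp add: tail_bs_def Let_def)
    qed
    show "f x \<in> aset (tail_bs Q (f x0)) \<alpha>" if \<alpha>: "\<alpha> \<in> arcs Q" "x \<in> aset X \<alpha>" for \<alpha> x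
    proof -
      have x: "x \<in> points X" using \<alpha> aset_points by blast
      then have "\<alpha> = arr x"
        using aset_unique[OF \<alpha>(2) arr_vset(2)[OF x] \<alpha>(1)] step[OF x] by simp
      then show ?thesis using mem[OF x] f[of x] by (simp add: tail_bs_def Let_def)
    qed
    show "f (sig X \<alpha> x) = sig (tail_bs Q (f x0)) \<alpha> (f x)"
      if "\<alpha> \<in> arcs Q" "x \<in> vset X (head Q \<alpha>)" for \<alpha> x
      using f_sig[OF that] by (simp add: tail_bs_def Let_def)
  qed (rule mem)
  with path[OF x0] show thesis by (rule that)
qed

end

theorem theorem5p4:
  fixes Q :: "('v, 'e) pre_digraph" and X :: "('v, 'e, 'x) branching"
  assumes "wf_digraph Q" and "branching_system Q X" and "perfect_bs Q X"
  shows "irreducible_representation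
           (leavitt_path_algebra Q :: ('k::field, ('v, 'e, 'k) falg set) kalg)
           (assoc_space X) (assoc_rep Q X)
         \<longleftrightarrow>
         (\<exists>p. left_infinite_path Q p \<and> bs_isomorphic Q X (tail_bs Q p)) \<or>
         (\<exists>i. sink Q i \<and> bs_isomorphic Q X (sink_bs Q i))"
    (is "?irr \<longleftrightarrow> ?tail \<or> ?sink")
proof
  have X: "perfect_branching_system Q X"
    using assms by (simp add: perfect_branching_system_def perfect_branching_system_axioms_def)
  then interpret X: perfect_branching_system Q X .
  show "?tail \<or> ?sink" if irr: ?irr
  proof (cases "\<exists>i z. sink Q i \<and> z \<in> vset X i")
    case True
    then show ?thesis
      using X.connected_sink_imp_isomorphic X.irreducible_imp_connected[OF irr] by blast
  next
    case False
    note con = X.irreducible_imp_connected[OF irr]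
    obtain p f where p: "left_infinite_path Q p" and f: "bs_morphism Q X (tail_bs Q p) f"
      using X.connected_imp_itinerary[OF con X.irreducible_imp_nonempty[OF irr]] False by blast
    interpret f: perfect_morphism Q X "tail_bs Q p" f
      using X f X.perfect_branching_system_tail_bs
      by (simp add: perfect_morphism_def perfect_morphism_axioms_def)
    \<comment> \<open>Here the morphism leaves \<open>X\<close>: surjectivity comes from
      connectedness of the target, and injectivity below uses irreducibility a second time.\<close>
    have "f ` points X = points (tail_bs Q p)"
      using f.Y.connected_imp_surj[OF X.tail_bs_connected X.irreducible_imp_nonempty[OF irr] X f] .
    then have "bs_isomorphic Q X (tail_bs Q p)"
      using f.isomorphicI f.irreducible_imp_inj[OF irr] by blast
    with p show ?thesis by blast
  qed
  show ?irr if "?tail \<or> ?sink"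
    using that
  proof (elim disjE exE conjE)
    fix p assume p: "left_infinite_path Q p" "bs_isomorphic Q X (tail_bs Q p)"
    have "p \<in> points (tail_bs Q p)" using p(1) by (auto simp: X.tail_bs_points tail_equivalent_def)
    then show ?irr
      using isomorphic_imp_irreducible[OF X X.perfect_branching_system_tail_bs p(2)
          X.tail_bs_connected X.tail_bs_separated] by blast
  next
    fix i assume i: "sink Q i" "bs_isomorphic Q X (sink_bs Q i)"
    have "(i, []) \<in> points (sink_bs Q i)"
      using i(1) by (simp add: X.sink_bs_points X.awalk_Nil_iff sink_def)
    then show ?irr
      using isomorphic_imp_irreducible[OF X X.perfect_branching_system_sink_bs[OF i(1)] i(2)
          X.sink_bs_connected X.sink_bs_separated[OF i(1)]] by blast
  qed
qed

end
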